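(* Consider the regression model $X_i=f(z_i)+\varepsilon_i$, $i=1,\dots,n$, with deterministic covariates $z_i\in[0,1]$ and i.i.d. $N(0,\sigma^2)$ errors with known $\sigma^2>0$. Assume that for some $\alpha\ge\frac12$ (with $\alpha\le q$) the true regression function $f_0$ has $\|f_0\|_\alpha<\infty$ and satisfies: for every $J$ there is $\beta_\infty\in\mathbb{R}^J$ (dependent on $J$) with $$\|\beta_\infty^TB-f_0\|_\infty\lesssim J^{-\alpha}\|f_0\|_\alpha.$$ Let the matrices $\Sigma_n=(\int B_iB_j\,d\mathbb{P}_n^z)_{i,j}$ satisfy $$J^{-1}\|\beta\|^2\lesssim\beta^T\Sigma_n\beta\lesssim J^{-1}\|\beta\|^2\qquad\text{for all }\beta\in\mathbb{R}^J,$$ and let $\Pi_n$ be the priors on $f=f_\beta=\beta^TB$ induced by a $N_J(0,I)$ distribution on the spline coefficients $\beta$. If $J=J_n\sim n^{1/(1+2\alpha)}$, then the posterior converges at the minimax rate $n^{-\alpha/(1+2\alpha)}$ relative to $\|\cdot\|_n$.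
   Context: $P_f^{(n)}$ is the law of $(X_1,\dots,X_n)$. $\mathbb{P}_n^z=n^{-1}\sum_{i=1}^n\delta_{z_i}$ and $\|\cdot\|_n$ is the norm of $L_2(\mathbb{P}_n^z)$; $\|\cdot\|$ is the Euclidean norm on $\mathbb{R}^J$ and $\|\cdot\|_\infty$ the uniform norm. The seminorm is $\|f\|_\alpha=\sup_{x\ne x'}|f^{(\alpha_0)}(x)-f^{(\alpha_0)}(x')|/|x-x'|^{\alpha-\alpha_0}$, where $\alpha_0$ is the greatest integer less than $\alpha$ and $f$ is $\alpha_0$ times continuously differentiable. Splines: $q\ge\alpha$ is a fixed integer; for $K\in\mathbb{N}$ the interval $(0,1]$ is partitioned into $((k-1)/K,k/K]$, $k=1,\dots,K$; the splines of order $q$ are the functions on $(0,1]$ that are $q-2$ times continuously differentiable and whose restriction to each subinterval is a polynomial of degree strictly less than $q$. They form a linear space of dimension $J=q+K-1$, with B-spline basis $B_1,\dots,B_J$ (the standard normalization: $B_j\ge0$, $\sum_jB_j=1$, each $B_j$ supported in an interval of length $q/K$, at most $q$ of them nonzero at any point). $B(z)=(B_1(z),\dots,B_J(z))^T$ and $\beta^TB$ is the function $z\mapsto\sum_j\beta_jB_j(z)$. $\lesssim$ denotes inequality up to a constant not depending on $n,J,\beta$; $a\sim b$ means of the same order. "The posterior converges at rate $\varepsilon_n$ relative to $\|\cdot\|_n$" means: $P_{f_0}^{(n)}\Pi_n(f:\|f-f_0\|_n\ge M_n\varepsilon_n\mid X_1,\dots,X_n)\to0$ for every $M_n\to\infty$.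 *)

theory Defs
  imports "HOL-Probability.Probability"
begin

section \<open>Hoelder seminorm on the unit interval\<close>

text \<open>Iterated derivatives on \<open>[0,1]\<close>, one-sided at the end points.\<close>

primrec deriv01 :: "nat \<Rightarrow> (real \<Rightarrow> real) \<Rightarrow> real \<Rightarrow> real" where
  "deriv01 0 f = f"
| "deriv01 (Suc k) f = (\<lambda>x. vector_derivative (deriv01 k f) (at x within {0..1}))"

definition C_k_01 :: "nat \<Rightarrow> (real \<Rightarrow> real) \<Rightarrow> bool" where
  "C_k_01 k f \<longleftrightarrow>
     (\<forall>i<k. deriv01 i f differentiable_on {0..1}) \<and> continuous_on {0..1} (deriv01 k f)"

text \<open>The inequality is strict, so that \<open>holder_order 1 = 0\<close>.\<close>

definition holder_order :: "real \<Rightarrow> nat" where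
  "holder_order \<alpha> = (GREATEST k. real k < \<alpha>)"

definition holder_seminorm :: "real \<Rightarrow> (real \<Rightarrow> real) \<Rightarrow> ennreal" where
  "holder_seminorm \<alpha> f =
     (SUP (x, y) \<in> {(x, y). x \<in> {0..1} \<and> y \<in> {0..1} \<and> x \<noteq> y}.
        ennreal (\<bar>deriv01 (holder_order \<alpha>) f x - deriv01 (holder_order \<alpha>) f y\<bar>
                   / \<bar>x - y\<bar> powr (\<alpha> - real (holder_order \<alpha>))))"

definition holder_class :: "real \<Rightarrow> (real \<Rightarrow> real) set" where
  "holder_class \<alpha> = {f. C_k_01 (holder_order \<alpha>) f \<and> holder_seminorm \<alpha> f < \<infinity>}"

definition unif_norm :: "(real \<Rightarrow> real) \<Rightarrow> ennreal" where
  "unif_norm f = (SUP x\<in>{0..1}. ennreal \<bar>f x\<bar>)"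


section \<open>B-splines\<close>

text \<open>
  \<open>spline_knots q K t\<close>: knots \<open>t 1 \<le> \<dots> \<le> t (2 q + K - 1)\<close> for the partition of \<open>(0,1]\<close> into
  \<open>((k-1)/K, k/K]\<close>, with \<open>t (q + k) = k/K\<close>. The \<open>q - 1\<close> auxiliary knots on each
  side of the interval are arbitrary, as usual: repeating the end points \<open>q\<close> times
  and continuing the uniform grid are both covered.
\<close>

definition spline_knots :: "nat \<Rightarrow> nat \<Rightarrow> (nat \<Rightarrow> real) \<Rightarrow> bool" where
  "spline_knots q K t \<longleftrightarrow>
     1 \<le> q \<and> 1 \<le> K \<and> mono_on {1..2*q + K - 1} t \<and> (\<forall>k\<le>K. t (q + k) = real k / real K)"

text \<open>
  \<open>bspline t q j\<close> is the \<open>j\<close>-th normalized B-spline of order \<open>q\<close> (degree \<open>q - 1\<close>) for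
  the knots \<open>t\<close>, by the Cox--de Boor recursion; division by zero being zero gives the
  usual convention for repeated knots. The pieces are left-open, and at \<open>0\<close>, which is
  a possible design point but lies in no piece \<open>((k-1)/K, k/K]\<close>, the B-splines
  are given the value of the polynomial on the first piece (their right limit).
\<close>

fun bspline :: "(nat \<Rightarrow> real) \<Rightarrow> nat \<Rightarrow> nat \<Rightarrow> real \<Rightarrow> real" where
  "bspline t 0 j x = 0"
| "bspline t (Suc 0) j x =
     (if x = 0 then of_bool (t j \<le> 0 \<and> 0 < t (Suc j)) else of_bool (t j < x \<and> x \<le> t (Suc j)))"
| "bspline t (Suc (Suc m)) j x =
     (x - t j) / (t (j + Suc m) - t j) * bspline t (Suc m) j x
     + (t (j + Suc (Suc m)) - x) / (t (j + Suc (Suc m)) - t (Suc j)) * bspline t (Suc m) (Suc j) x"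

text \<open>The function \<open>\<beta>\<^sup>T B\<close>.\<close>

definition spline_fun :: "nat \<Rightarrow> (nat \<Rightarrow> real) \<Rightarrow> nat \<Rightarrow> (nat \<Rightarrow> real) \<Rightarrow> real \<Rightarrow> real" where
  "spline_fun q t J \<beta> x = (\<Sum>j=1..J. \<beta> j * bspline t q j x)"

lemma bspline_local_aux:
  assumes "mono_on {1..N} t" "1 \<le> j" "j + m \<le> N"
    and "\<not> (if x = 0 then t j \<le> 0 \<and> 0 < t (j + m) else t j < x \<and> x \<le> t (j + m))"
  shows "bspline t m j x = 0"
  using assms
proof (induction t m j x rule: bspline.induct)
  case (3 t m j x)
  have mono: "t a \<le> t b" if "1 \<le> a" "a \<le> b" "b \<le> N" for a b
    using 3(3) that by (auto simp: mono_on_def)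
  have "t j \<le> t (Suc j)" "t (j + Suc m) \<le> t (j + Suc (Suc m))"
    using 3(4,5) by (auto intro!: mono)
  then have "bspline t (Suc m) j x = 0" "bspline t (Suc m) (Suc j) x = 0"
    using 3(3-6) by (intro 3(1) 3(2); force split: if_splits)+
  then show ?case by simp
qed auto

lemma bspline_nonneg_aux:
  assumes "mono_on {1..N} t" "1 \<le> j" "j + m \<le> N"
  shows "0 \<le> bspline t m j x"
  using assms
proof (induction t m j x rule: bspline.induct)
  case (3 t m j x)
  have mono: "t a \<le> t b" if "1 \<le> a" "a \<le> b" "b \<le> N" for a b
    using 3(3) that by (auto simp: mono_on_def)
  have "0 \<le> (x - t j) / (t (j + Suc m) - t j) * bspline t (Suc m) j x"
  proof (cases "bspline t (Suc m) j x = 0")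
    case False
    then have "t j \<le> x"
      using bspline_local_aux[of N t j "Suc m" x] 3(3-5) by (force split: if_splits)
    then show ?thesis
      using 3 by (intro mult_nonneg_nonneg divide_nonneg_nonneg) (auto intro!: mono)
  qed simp
  moreover have "0 \<le> (t (j + Suc (Suc m)) - x) / (t (j + Suc (Suc m)) - t (Suc j))
      * bspline t (Suc m) (Suc j) x"
  proof (cases "bspline t (Suc m) (Suc j) x = 0")
    case False
    then have "x \<le> t (j + Suc (Suc m))"
      using bspline_local_aux[of N t "Suc j" "Suc m" x] 3(3-5) by (force split: if_splits)
    then show ?thesis
      using 3 by (intro mult_nonneg_nonneg divide_nonneg_nonneg) (auto intro!: mono)
  qed simp
  ultimately show ?case by simp
qed auto

lemma bspline_sum_aux:
  assumes "spline_knots q K t" "x \<in> {0..1}" "m < q"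
  shows "(\<Sum>j=q-m..q+K-1. bspline t (Suc m) j x) = 1"
  using assms(3)
proof (induction m)
  case 0
  have K: "K \<ge> 1" "q \<ge> 1" and t: "\<And>k. k \<le> K \<Longrightarrow> t (q + k) = real k / real K"
    using assms by (auto simp: spline_knots_def)
  define k where "k = (if x = 0 then 0 else nat (\<lceil>x * real K\<rceil> - 1))"
  have k: "k < K" "(if x = 0 then k = 0 else real k < x * real K \<and> x * real K \<le> real k + 1)"
  proof -
    have le: "x * real K \<le> real K" using assms(2) K by (simp add: mult_left_le_one_le)
    have "k < K \<and> real k < x * real K \<and> x * real K \<le> real k + 1" if "x \<noteq> 0"
    proof -
      have "0 < x * real K" using that assms(2) K by auto
      then have "0 < \<lceil>x * real K\<rceil>" by simp
      moreover have "\<lceil>x * real K\<rceil> \<le> int K" using le by (simp add: ceiling_le_iff)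
      ultimately have "int k = \<lceil>x * real K\<rceil> - 1" "k < K"
        using that unfolding k_def by (simp_all only: if_False)
      moreover from this(1) have "real k = real_of_int \<lceil>x * real K\<rceil> - 1"
        by (metis of_int_1 of_int_diff of_int_of_nat_eq)
      ultimately show ?thesis using ceiling_correct[of "x * real K"] by auto
    qed
    then show "k < K" "(if x = 0 then k = 0 else real k < x * real K \<and> x * real K \<le> real k + 1)"
      using K by (auto simp: k_def)
  qed
  have "bspline t (Suc 0) j x = of_bool (j = q + k)" if "j \<in> {q..q+K-1}" for j
  proof -
    define i where "i = j - q"
    have i: "j = q + i" "i < K"
      using \<open>j \<in> {q..q+K-1}\<close> K by (auto simp: i_def)
    have "t j = real i / real K" "t (Suc j) = real (Suc i) / real K"
      using i t[of i] t[of "Suc i"] by auto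
    moreover have "(real i < x * real K \<and> x * real K \<le> real i + 1) = (i = k)" if "x \<noteq> 0"
      using k(2) that by auto
    ultimately show ?thesis
      using i K k(2) by (cases "x = 0") (auto simp: divide_less_eq le_divide_eq divide_le_0_iff add.commute)
  qed
  then have "(\<Sum>j=q-0..q+K-1. bspline t (Suc 0) j x) = (\<Sum>j=q..q+K-1. of_bool (j = q + k))"
    by (intro sum.cong) auto
  also have "\<dots> = 1"
    using k(1) K by (simp add: of_bool_def sum.delta)
  finally show ?case .
next
  case (Suc m)
  have K: "K \<ge> 1" "q \<ge> 1" and mono: "mono_on {1..2*q+K-1} t"
    and t: "\<And>k. k \<le> K \<Longrightarrow> t (q + k) = real k / real K"
    using assms by (auto simp: spline_knots_def)
  have t0: "t q = 0" "t (q + K) = 1" using t[of 0] t[of K] K by auto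
  define w where "w j = (x - t j) / (t (j + Suc m) - t j) * bspline t (Suc m) j x" for j
  define v where "v j = (t (j + Suc m) - x) / (t (j + Suc m) - t j) * bspline t (Suc m) j x" for j
  define a b where "a = q - Suc m" and "b = q + K - 1"
  have ab: "a \<le> b" "Suc a = q - m" "Suc b = q + K" "a \<ge> 1" "a + Suc m = q"
    using Suc.prems K by (auto simp: a_def b_def)
  have wv: "w j + v j = bspline t (Suc m) j x" if "j \<in> {Suc a..b}" for j
  proof (cases "t (j + Suc m) = t j")
    case True
    have "j + Suc m \<le> 2*q+K-1" "1 \<le> j" using that ab Suc.prems by auto
    then have "bspline t (Suc m) j x = 0"
      using True by (intro bspline_local_aux[OF mono]) auto
    then show ?thesis by (simp add: w_def v_def)
  next
    case False
    then have "(x - t j) / (t (j + Suc m) - t j) + (t (j + Suc m) - x) / (t (j + Suc m) - t j) = 1"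
      by (simp add: add_divide_distrib[symmetric])
    then show ?thesis unfolding w_def v_def distrib_right[symmetric] by simp
  qed
  have "bspline t (Suc m) a x = 0"
    using ab t0 assms(2) Suc.prems by (intro bspline_local_aux[OF mono]) auto
  then have wa: "w a = 0" by (simp add: w_def)
  have "bspline t (Suc m) (Suc b) x = 0"
    unfolding ab(3) using ab t0 assms(2) Suc.prems by (intro bspline_local_aux[OF mono]) auto
  then have vb: "v (Suc b) = 0" by (simp add: v_def)
  have "(\<Sum>j=q-Suc m..q+K-1. bspline t (Suc (Suc m)) j x) = (\<Sum>j=a..b. w j + v (Suc j))"
    by (simp add: a_def b_def w_def v_def)
  also have "\<dots> = (\<Sum>j=a..b. w j) + (\<Sum>j=Suc a..Suc b. v j)"
    by (simp only: sum.distrib sum.shift_bounds_cl_Suc_ivl)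
  also have "(\<Sum>j=a..b. w j) = (\<Sum>j=Suc a..b. w j)"
    using ab wa by (simp add: sum.atLeast_Suc_atMost)
  also have "(\<Sum>j=Suc a..Suc b. v j) = (\<Sum>j=Suc a..b. v j)"
    using ab(1) vb by (simp only: sum.nat_ivl_Suc' Suc_le_mono le_SucI add_0)
  also have "(\<Sum>j=Suc a..b. w j) + (\<Sum>j=Suc a..b. v j) = (\<Sum>j=Suc a..b. bspline t (Suc m) j x)"
    using wv by (simp add: sum.distrib[symmetric])
  also have "\<dots> = 1"
    using Suc ab by (simp add: b_def)
  finally show ?case .
qed

lemma bspline_normalization:
  assumes "spline_knots q K t"
  shows "j \<in> {1..q+K-1} \<Longrightarrow> 0 \<le> bspline t q j x"
    and "j \<in> {1..q+K-1} \<Longrightarrow> x \<notin> {t j..t (j+q)} \<Longrightarrow> bspline t q j x = 0"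
    and "x \<in> {0..1} \<Longrightarrow> (\<Sum>j=1..q+K-1. bspline t q j x) = 1"
proof -
  have *: "mono_on {1..2*q+K-1} t" "q \<ge> 1" "K \<ge> 1" using assms by (auto simp: spline_knots_def)
  show "0 \<le> bspline t q j x" if "j \<in> {1..q+K-1}"
    using * that by (intro bspline_nonneg_aux[OF *(1)]) auto
  show "bspline t q j x = 0" if "j \<in> {1..q+K-1}" "x \<notin> {t j..t (j+q)}"
    using * that by (intro bspline_local_aux[OF *(1)]) (auto split: if_splits)
  show "(\<Sum>j=1..q+K-1. bspline t q j x) = 1" if "x \<in> {0..1}"
    using bspline_sum_aux[OF assms that, of "q - 1"] * by simp
qed


section \<open>The regression model, the prior and the posterior\<close>

definition design_measure :: "(nat \<Rightarrow> real) \<Rightarrow> nat \<Rightarrow> real pmf" where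
  "design_measure z n = map_pmf z (pmf_of_set {1..n})"

definition design_norm :: "(nat \<Rightarrow> real) \<Rightarrow> nat \<Rightarrow> (real \<Rightarrow> real) \<Rightarrow> real" where
  "design_norm z n f = sqrt (\<integral>x. (f x)\<^sup>2 \<partial>measure_pmf (design_measure z n))"

definition design_gram ::
  "(nat \<Rightarrow> real) \<Rightarrow> nat \<Rightarrow> nat \<Rightarrow> (nat \<Rightarrow> real) \<Rightarrow> nat \<Rightarrow> nat \<Rightarrow> real" where
  "design_gram z n q t i j =
     (\<integral>x. bspline t q i x * bspline t q j x \<partial>measure_pmf (design_measure z n))"

abbreviation normal_law :: "real \<Rightarrow> real \<Rightarrow> real measure" where
  "normal_law \<mu> \<sigma> \<equiv> density lborel (\<lambda>x. ennreal (normal_density \<mu> \<sigma> x))"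

text \<open>The law of \<open>(X\<^sub>1, \<dots>, X\<^sub>n)\<close> with \<open>X\<^sub>i = f (z\<^sub>i) + \<epsilon>\<^sub>i\<close> for i.i.d.\ \<open>N(0, \<sigma>\<^sup>2)\<close> errors.\<close>

definition regression_law ::
  "(nat \<Rightarrow> real) \<Rightarrow> real \<Rightarrow> nat \<Rightarrow> (real \<Rightarrow> real) \<Rightarrow> (nat \<Rightarrow> real) measure" where
  "regression_law z \<sigma> n f =
     distr (PiM {1..n} (\<lambda>_. normal_law 0 \<sigma>)) (PiM {1..n} (\<lambda>_. borel))
       (\<lambda>e. \<lambda>i\<in>{1..n}. f (z i) + e i)"

definition regression_likelihood ::
  "(nat \<Rightarrow> real) \<Rightarrow> real \<Rightarrow> nat \<Rightarrow> (real \<Rightarrow> real) \<Rightarrow> (nat \<Rightarrow> real) \<Rightarrow> real" where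
  "regression_likelihood z \<sigma> n f X = (\<Prod>i=1..n. normal_density (f (z i)) \<sigma> (X i))"

lemma distr_normal_law_shift:
  assumes "\<sigma> > 0"
  shows "distr (normal_law 0 \<sigma>) borel (\<lambda>e. \<mu> + e) = normal_law \<mu> \<sigma>"
proof -
  interpret prob_space "normal_law 0 \<sigma>" using assms by (rule prob_space_normal_density)
  have "distributed (normal_law 0 \<sigma>) lborel (\<lambda>x. x) (normal_density 0 \<sigma>)"
    by (auto simp: distributed_def distr_id2)
  from normal_density_affine[OF this assms, of 1 \<mu>]
  have "distr (normal_law 0 \<sigma>) lborel (\<lambda>e. \<mu> + e) = normal_law \<mu> \<sigma>"
    by (simp add: distributed_def)
  then show ?thesis
    by (metis distr_cong sets_lborel)
qed

lemma regression_law_eq_PiM: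
  assumes "\<sigma> > 0"
  shows "regression_law z \<sigma> n f = PiM {1..n} (\<lambda>i. normal_law (f (z i)) \<sigma>)"
proof (rule product_sigma_finite.PiM_eqI)
  interpret A: product_prob_space "\<lambda>i. normal_law (f (z i)) \<sigma>"
    using assms by (intro product_prob_spaceI prob_space_normal_density) auto
  interpret N: product_prob_space "\<lambda>_::nat. normal_law 0 \<sigma>"
    using assms by (intro product_prob_spaceI prob_space_normal_density) auto
  show "product_sigma_finite (\<lambda>i. normal_law (f (z i)) \<sigma>)" by unfold_locales
  show "finite {1..n}" by simp
  show "sets (regression_law z \<sigma> n f) = sets (PiM {1..n} (\<lambda>i. normal_law (f (z i)) \<sigma>))"
    by (auto simp: regression_law_def intro!: sets_PiM_cong)
  fix A assume A: "\<And>i. i \<in> {1..n} \<Longrightarrow> A i \<in> sets (normal_law (f (z i)) \<sigma>)"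
  then have A': "\<And>i. i \<in> {1..n} \<Longrightarrow> A i \<in> sets borel" by simp
  let ?g = "\<lambda>e::nat\<Rightarrow>real. \<lambda>i\<in>{1..n}. f (z i) + e i"
  have meas: "?g \<in> measurable (PiM {1..n} (\<lambda>_. normal_law 0 \<sigma>)) (PiM {1..n} (\<lambda>_. borel))"
    by (rule measurable_restrict) measurable
  have "emeasure (regression_law z \<sigma> n f) (Pi\<^sub>E {1..n} A)
      = emeasure (PiM {1..n} (\<lambda>_. normal_law 0 \<sigma>))
         (?g -` Pi\<^sub>E {1..n} A \<inter> space (PiM {1..n} (\<lambda>_. normal_law 0 \<sigma>)))"
    unfolding regression_law_def using A' meas
    by (subst emeasure_distr) (auto intro!: sets_PiM_I_finite)
  also have "?g -` Pi\<^sub>E {1..n} A \<inter> space (PiM {1..n} (\<lambda>_. normal_law 0 \<sigma>))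
      = Pi\<^sub>E {1..n} (\<lambda>i. (\<lambda>e. f (z i) + e) -` A i)"
    by (auto simp: space_PiM PiE_iff)
  also have "emeasure (PiM {1..n} (\<lambda>_. normal_law 0 \<sigma>)) \<dots>
      = (\<Prod>i=1..n. emeasure (normal_law 0 \<sigma>) ((\<lambda>e. f (z i) + e) -` A i))"
  proof (rule N.emeasure_PiM)
    fix i assume "i \<in> {1..n}"
    have "(\<lambda>e. f (z i) + e) \<in> borel_measurable borel" by measurable
    from measurable_sets[OF this A'[OF \<open>i \<in> {1..n}\<close>]]
    show "(\<lambda>e. f (z i) + e) -` A i \<in> sets (normal_law 0 \<sigma>)" by simp
  qed simp
  also have "\<dots> = (\<Prod>i=1..n. emeasure (normal_law (f (z i)) \<sigma>) (A i))"
  proof (rule prod.cong)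
    fix i assume i: "i \<in> {1..n}"
    show "emeasure (normal_law 0 \<sigma>) ((\<lambda>e. f (z i) + e) -` A i)
        = emeasure (normal_law (f (z i)) \<sigma>) (A i)"
      using A'[OF i]
      by (subst distr_normal_law_shift[OF assms, symmetric], subst emeasure_distr) auto
  qed simp
  finally show "emeasure (regression_law z \<sigma> n f) (Pi\<^sub>E {1..n} A)
      = (\<Prod>i=1..n. emeasure (normal_law (f (z i)) \<sigma>) (A i))" .
qed

text \<open>
  Priors are measures on functions, for the sigma-algebra generated by the point
  evaluations. This one is the law of \<open>\<beta>\<^sup>T B\<close> for \<open>\<beta>\<close> distributed as \<open>N\<^sub>J(0, I)\<close>.
\<close>

definition spline_prior ::
  "nat \<Rightarrow> (nat \<Rightarrow> real) \<Rightarrow> nat \<Rightarrow> (real \<Rightarrow> real) measure" where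
  "spline_prior q t J =
     distr (PiM {1..J} (\<lambda>_. normal_law 0 1)) (PiM UNIV (\<lambda>_. borel)) (spline_fun q t J)"

text \<open>Posterior probability of a set of functions, by Bayes' formula.\<close>

definition posterior ::
  "(nat \<Rightarrow> real) \<Rightarrow> real \<Rightarrow> nat \<Rightarrow> (real \<Rightarrow> real) measure \<Rightarrow> (nat \<Rightarrow> real)
     \<Rightarrow> (real \<Rightarrow> real) set \<Rightarrow> real" where
  "posterior z \<sigma> n prior X A =
     (\<integral>f. indicator A f * regression_likelihood z \<sigma> n f X \<partial>prior)
     / (\<integral>f. regression_likelihood z \<sigma> n f X \<partial>prior)"

text \<open>The design may be a triangular array: \<open>z n i\<close> is the \<open>i\<close>-th of \<open>n\<close> design points.\<close>

definition posterior_converges_at_rate ::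
  "(nat \<Rightarrow> nat \<Rightarrow> real) \<Rightarrow> real \<Rightarrow> (nat \<Rightarrow> (real \<Rightarrow> real) measure) \<Rightarrow> (real \<Rightarrow> real)
     \<Rightarrow> (nat \<Rightarrow> real) \<Rightarrow> bool" where
  "posterior_converges_at_rate z \<sigma> prior f\<^sub>0 \<epsilon> \<longleftrightarrow>
     (\<forall>M. filterlim M at_top sequentially \<longrightarrow>
        (\<lambda>n. \<integral>X. posterior (z n) \<sigma> n (prior n) X
                   {f. design_norm (z n) n (\<lambda>x. f x - f\<^sub>0 x) \<ge> M n * \<epsilon> n}
              \<partial>regression_law (z n) \<sigma> n f\<^sub>0) \<longlonglongrightarrow> 0)"

end

theory Submission
  imports Defs
begin

text \<open>
  Centre the coefficients at the approximating spline \<open>\<beta>\<^sub>\<infinity>\<close>, \<open>h = \<beta> - \<beta>\<^sub>\<infinity>\<close>. The log-likelihood is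
  \<open>\<langle>g, h\<rangle> - S h\<close> up to a constant, with \<open>g\<close> linear in the data and \<open>S\<close> a quadratic form which the
  Gram condition places between \<open>\<lambda>/2 \<parallel>h\<parallel>\<^sup>2\<close> and \<open>\<Lambda>/2 \<parallel>h\<parallel>\<^sup>2\<close>, where \<open>\<lambda>\<close> and \<open>\<Lambda>\<close> are both of order
  \<open>n/J\<close>. Replacing \<open>S\<close> by these isotropic bounds in the numerator and the denominator of Bayes'
  formula turns all integrals over the product prior into products of explicit one-dimensional
  Gaussian integrals and costs only a factor \<open>exp (O(J))\<close>. By a Chernoff bound the posterior mass
  of \<open>{\<parallel>h\<parallel>\<^sup>2 \<ge> r}\<close> is at most \<open>exp (Y + O(J) - R)\<close>, where \<open>Y\<close> is a squared linear statistic
  of the data with expectation \<open>O(J)\<close> and \<open>R\<close> is of order \<open>r n/J\<close>. At the rate in question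
  \<open>J \<sim> n \<epsilon>\<^sub>n\<^sup>2\<close>, so that \<open>R\<close> exceeds any multiple of \<open>J\<close> as \<open>M\<^sub>n \<rightarrow> \<infinity>\<close>.
\<close>

section \<open>Gaussian integrals over product measures\<close>

lemma (in product_prob_space) has_bochner_integral_PiM_prod:
  fixes f :: "'i \<Rightarrow> 'a \<Rightarrow> real"
  assumes "finite I" "\<And>i. i \<in> I \<Longrightarrow> has_bochner_integral (M i) (f i) (c i)"
  shows "has_bochner_integral (PiM I M) (\<lambda>x. \<Prod>i\<in>I. f i (x i)) (\<Prod>i\<in>I. c i)"
proof -
  have int: "integrable (M i) (f i)" "integral\<^sup>L (M i) (f i) = c i" if "i \<in> I" for i
    using assms(2)[OF that] by (auto simp: has_bochner_integral_iff)
  show ?thesis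
    unfolding has_bochner_integral_iff
    using int product_integrable_prod[OF assms(1), of f] product_integral_prod[OF assms(1), of f]
    by (auto intro!: prod.cong)
qed

lemma has_bochner_integral_normal_law:
  assumes "0 < \<sigma>" "f \<in> borel_measurable borel"
    and "has_bochner_integral lborel (\<lambda>x. normal_density \<mu> \<sigma> x * f x) c"
  shows "has_bochner_integral (normal_law \<mu> \<sigma>) f c"
  using assms by (intro has_bochner_integral_density) auto

lemma product_prob_space_normal_law:
  "0 < \<sigma> \<Longrightarrow> product_prob_space (\<lambda>i. normal_law (\<mu> i) \<sigma>)"
  by (intro product_prob_spaceI prob_space_normal_density)

lemma normal_law_centered_moments:
  assumes "0 < \<sigma>"
  shows "has_bochner_integral (normal_law \<mu> \<sigma>) (\<lambda>x. x - \<mu>) 0"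
    and "has_bochner_integral (normal_law \<mu> \<sigma>) (\<lambda>x. (x - \<mu>) * (x - \<mu>)) (\<sigma>\<^sup>2)"
    and "has_bochner_integral (normal_law \<mu> \<sigma>) (\<lambda>x. 1) (1::real)"
proof -
  show "has_bochner_integral (normal_law \<mu> \<sigma>) (\<lambda>x. x - \<mu>) 0"
    using normal_moment_odd[OF assms, of \<mu> 0]
    by (intro has_bochner_integral_normal_law assms) auto
  show "has_bochner_integral (normal_law \<mu> \<sigma>) (\<lambda>x. (x - \<mu>) * (x - \<mu>)) (\<sigma>\<^sup>2)"
    using normal_moment_even[OF assms, of \<mu> 1]
    by (intro has_bochner_integral_normal_law assms) (auto simp: power2_eq_square)
  show "has_bochner_integral (normal_law \<mu> \<sigma>) (\<lambda>x. 1) (1::real)"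
    using normal_moment_even[OF assms, of \<mu> 0]
    by (intro has_bochner_integral_normal_law assms) auto
qed

text \<open>Variance plus squared bias: in the expanded square only the diagonal covariances
  survive, and the linear term integrates to 0. It serves to compute the expectation of the data
  statistic that bounds the posterior mass.\<close>

lemma normal_linear_form_second_moment:
  fixes a \<mu> :: "'i \<Rightarrow> real"
  assumes "0 < \<sigma>" "finite I"
  shows "has_bochner_integral (PiM I (\<lambda>i. normal_law (\<mu> i) \<sigma>))
           (\<lambda>x. ((\<Sum>i\<in>I. a i * (x i - \<mu> i)) + m)\<^sup>2) (\<sigma>\<^sup>2 * (\<Sum>i\<in>I. (a i)\<^sup>2) + m\<^sup>2)"
proof -
  interpret product_prob_space "\<lambda>i. normal_law (\<mu> i) \<sigma>" I
    by (rule product_prob_space_normal_law) fact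
  let ?P = "PiM I (\<lambda>i. normal_law (\<mu> i) \<sigma>)"
  note mom = normal_law_centered_moments[OF assms(1)]
  \<comment> \<open>For the product formula, the product of two centred coordinates is written as a
    product over all of \<open>I\<close>. Factor \<open>l\<close> has mean
    \<open>\<sigma>\<^sup>2\<close> if \<open>l\<close> is hit twice, 0 if hit once and 1 otherwise,
    so distinct indices give 0.\<close>
  have two: "has_bochner_integral ?P (\<lambda>x. (x i - \<mu> i) * (x k - \<mu> k)) (if i = k then \<sigma>\<^sup>2 else 0)"
    if "i \<in> I" "k \<in> I" for i k
  proof -
    have "has_bochner_integral ?P
       (\<lambda>x. \<Prod>l\<in>I. (if l = i then x l - \<mu> l else 1) * (if l = k then x l - \<mu> l else 1))
       (\<Prod>l\<in>I. if l = i then (if l = k then \<sigma>\<^sup>2 else 0) else (if l = k then 0 else 1))"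
      using mom by (intro has_bochner_integral_PiM_prod assms) auto
    also have "(\<lambda>x. \<Prod>l\<in>I. (if l = i then x l - \<mu> l else 1) * (if l = k then x l - \<mu> l else 1))
       = (\<lambda>x. (x i - \<mu> i) * (x k - \<mu> k))"
      using that assms by (simp add: prod.distrib prod.delta)
    also have "(\<Prod>l\<in>I. if l = i then (if l = k then \<sigma>\<^sup>2 else 0) else (if l = k then 0 else 1))
       = (if i = k then \<sigma>\<^sup>2 else 0)"
    proof (cases "i = k")
      case True
      have "(\<Prod>l\<in>I. if l = i then (if l = k then \<sigma>\<^sup>2 else 0) else (if l = k then 0 else 1))
         = (\<Prod>l\<in>I. if l = k then \<sigma>\<^sup>2 else 1)"
        using True by (intro prod.cong) auto
      then show ?thesis using True that assms by (simp add: prod.delta)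
    next
      case False
      then have "(\<Prod>l\<in>I. if l = i then (if l = k then \<sigma>\<^sup>2 else 0) else (if l = k then 0 else 1)) = 0"
        using that assms by (intro prod_zero) auto
      with False show ?thesis by simp
    qed
    finally show ?thesis .
  qed
  have one: "has_bochner_integral ?P (\<lambda>x. x i - \<mu> i) 0" if "i \<in> I" for i
  proof -
    have "has_bochner_integral ?P (\<lambda>x. \<Prod>l\<in>I. (if l = i then x l - \<mu> l else 1))
       (\<Prod>l\<in>I. if l = i then 0 else 1)"
      using mom by (intro has_bochner_integral_PiM_prod assms) auto
    then show ?thesis using that assms by (simp add: prod.delta)
  qed
  have const: "has_bochner_integral ?P (\<lambda>x. c) c" for c :: real
    by (simp add: has_bochner_integral_iff P.prob_space)
  have "has_bochner_integral ?P
     (\<lambda>x. (\<Sum>i\<in>I. \<Sum>k\<in>I. a i * a k * ((x i - \<mu> i) * (x k - \<mu> k)))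
          + (\<Sum>i\<in>I. (2 * m * a i) * (x i - \<mu> i)) + m\<^sup>2)
     ((\<Sum>i\<in>I. \<Sum>k\<in>I. a i * a k * (if i = k then \<sigma>\<^sup>2 else 0))
          + (\<Sum>i\<in>I. (2 * m * a i) * 0) + m\<^sup>2)"
    using two one const
    by (intro has_bochner_integral_add has_bochner_integral_sum has_bochner_integral_mult_right) auto
  also have "(\<lambda>x. (\<Sum>i\<in>I. \<Sum>k\<in>I. a i * a k * ((x i - \<mu> i) * (x k - \<mu> k)))
          + (\<Sum>i\<in>I. (2 * m * a i) * (x i - \<mu> i)) + m\<^sup>2)
      = (\<lambda>x. ((\<Sum>i\<in>I. a i * (x i - \<mu> i)) + m)\<^sup>2)"
    by (rule ext) (simp add: power2_sum power2_eq_square sum_product sum_distrib_left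
        sum_distrib_right algebra_simps)
  also have "((\<Sum>i\<in>I. \<Sum>k\<in>I. a i * a k * (if i = k then \<sigma>\<^sup>2 else 0))
          + (\<Sum>i\<in>I. (2 * m * a i) * 0) + m\<^sup>2) = \<sigma>\<^sup>2 * (\<Sum>i\<in>I. (a i)\<^sup>2) + m\<^sup>2"
    using assms by (simp add: if_distrib sum.delta power2_eq_square sum_distrib_left mult_ac cong: if_cong)
  finally show ?thesis .
qed

lemma std_normal_quadratic_tilt:
  fixes u v b :: real
  assumes "v > -1"
  shows "has_bochner_integral (normal_law 0 1) (\<lambda>x. exp (u * (x - b) - v / 2 * (x - b)\<^sup>2))
           (exp ((u - b)\<^sup>2 / (2 * (v + 1)) - b\<^sup>2 / 2) / sqrt (v + 1))"
proof (rule has_bochner_integral_normal_law)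
  define w where "w = v + 1"
  have w: "w > 0" and v: "v = w - 1" using assms by (auto simp: w_def)
  define c where "c = exp ((u - b)\<^sup>2 / (2 * w) - b\<^sup>2 / 2) / sqrt w"
  define s where "s = 1 / sqrt w"
  have s: "s > 0" "s\<^sup>2 = 1 / w" using w by (auto simp: s_def power_divide)
  define p where "p = b + (u - b) / w"
  \<comment> \<open>The even moment of order 0 is the total mass of the density.\<close>
  have "has_bochner_integral lborel (\<lambda>x. c * (normal_density p s x * (x - p) ^ (2 * 0)))
          (c * (fact (2 * 0) / ((2 / s\<^sup>2) ^ 0 * fact 0)))"
    by (intro has_bochner_integral_mult_right normal_moment_even s)
  moreover have "c * (normal_density p s x * (x - p) ^ (2 * 0))
      = normal_density 0 1 x * exp (u * (x - b) - v / 2 * (x - b)\<^sup>2)" for x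
  proof -
    have 1: "c * normal_density p s x
        = exp ((u - b)\<^sup>2 / (2 * w) - b\<^sup>2 / 2) * exp (- ((x - p)\<^sup>2 * w / 2)) / sqrt (2 * pi)"
      using w by (simp add: c_def normal_density_def s real_sqrt_divide real_sqrt_mult)
    have 2: "(u - b)\<^sup>2 / (2 * w) - b\<^sup>2 / 2 + - ((x - p)\<^sup>2 * w / 2)
       = - (x\<^sup>2 / 2) + (u * (x - b) - v / 2 * (x - b)\<^sup>2)"
      unfolding p_def v using w by (simp add: field_simps power2_eq_square)
    have "c * normal_density p s x
        = exp (- (x\<^sup>2 / 2)) * exp (u * (x - b) - v / 2 * (x - b)\<^sup>2) / sqrt (2 * pi)"
      unfolding 1 exp_add[symmetric] 2 by simp
    then show ?thesis by (simp add: normal_density_def)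
  qed
  ultimately show "has_bochner_integral lborel
      (\<lambda>x. normal_density 0 1 x * exp (u * (x - b) - v / 2 * (x - b)\<^sup>2))
      (exp ((u - b)\<^sup>2 / (2 * (v + 1)) - b\<^sup>2 / 2) / sqrt (v + 1))"
    by (simp add: c_def w_def)
qed auto

section \<open>Posterior mass under a standard Gaussian prior\<close>

text \<open>
  A bound linear in \<open>y\<close>, so that only the expectation of the statistic \<open>Y\<close> is needed and no
  event of large noise has to be split off.
\<close>

lemma min_one_exp_le:
  fixes y R :: real
  assumes "p \<le> 1" "p \<le> exp (y - R)" "0 \<le> y" "0 < R"
  shows "p \<le> (1 + y) / R"
proof (cases "y \<ge> R")
  case True
  have "p * R \<le> 1 * R"
    using assms by (intro mult_right_mono) auto
  then have "p * R \<le> 1 + y" using True by linarith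
  then show ?thesis using assms by (simp add: le_divide_eq)
next
  case False
  have "p * (1 + (R - y)) \<le> 1"
  proof (cases "p \<le> 0")
    case True
    then show ?thesis using False by (smt (verit) mult_nonpos_nonneg)
  next
    case F: False
    have "p * (1 + (R - y)) \<le> exp (y - R) * exp (R - y)"
      using assms F False exp_ge_add_one_self[of "R - y"] by (intro mult_mono) auto
    then show ?thesis by (simp add: exp_add[symmetric])
  qed
  \<comment> \<open>\<open>(1 + y) * (1 + (R - y))\<close> equals \<open>1 + R + y * (R - y)\<close>
    and hence dominates \<open>R\<close>. The positive factor \<open>1 + (R - y)\<close> can then be
    cancelled.\<close>
  moreover have "0 \<le> y * (R - y)" using False assms by simp
  then have "R \<le> (1 + y) * (1 + (R - y))" by (simp add: algebra_simps)
  moreover have "R * (p * (1 + (R - y))) \<le> R * 1"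
    using assms calculation(1) by (intro mult_left_mono) auto
  ultimately have "p * R * (1 + (R - y)) \<le> (1 + y) * (1 + (R - y))"
    by (simp add: mult_ac)
  then have "p * R \<le> 1 + y" using False by (simp add: mult_le_cancel_right)
  then show ?thesis using assms by (simp add: le_divide_eq)
qed

text \<open>Of the precision \<open>lam + 1\<close> of likelihood and prior together, one half keeps
  the numerator integral finite; the other half, evaluated where \<open>ind\<close> is nonzero,
  yields \<open>exp (- R)\<close> with \<open>R = (lam + 1) / 4 * r\<close>. The denominator is
  bounded below with \<open>Lam\<close>. Both bounds factor over the coordinates, and the ratio of
  factors costs \<open>(g j - b j)\<^sup>2 / (lam + 1)\<close> for the linear term and
  \<open>ln (2 * \<kappa>) / 2\<close> for the normalizing square roots.\<close>

lemma gaussian_prior_posterior_bound: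
  fixes L S ind :: "('i \<Rightarrow> real) \<Rightarrow> real" and g b :: "'i \<Rightarrow> real" and I :: "'i set"
  defines "N \<equiv> PiM I (\<lambda>_. normal_law 0 1)"
  assumes I: "finite I" and L [measurable]: "L \<in> borel_measurable N" and K: "0 < K"
    and L_eq: "\<And>\<beta>. L \<beta> = K * exp ((\<Sum>j\<in>I. g j * (\<beta> j - b j)) - S \<beta>)"
    and S_lower: "\<And>\<beta>. lam / 2 * (\<Sum>j\<in>I. (\<beta> j - b j)\<^sup>2) \<le> S \<beta>"
    and S_upper: "\<And>\<beta>. S \<beta> \<le> Lam / 2 * (\<Sum>j\<in>I. (\<beta> j - b j)\<^sup>2)"
    and lam: "0 \<le> lam" "0 \<le> Lam" "Lam + 1 \<le> \<kappa> * (lam + 1)" "1 \<le> \<kappa>"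
    and ind: "\<And>\<beta>. 0 \<le> ind \<beta>" "\<And>\<beta>. ind \<beta> \<le> 1"
    and ind_far: "\<And>\<beta>. ind \<beta> \<noteq> 0 \<Longrightarrow> r \<le> (\<Sum>j\<in>I. (\<beta> j - b j)\<^sup>2)"
    and r: "0 < r"
  shows "(\<integral>\<beta>. ind \<beta> * L \<beta> \<partial>N) / (\<integral>\<beta>. L \<beta> \<partial>N)
     \<le> (1 + ((\<Sum>j\<in>I. (g j - b j)\<^sup>2) / (lam + 1) + real (card I) * (ln (2 * \<kappa>) / 2)))
         / ((lam + 1) / 4 * r)" (is "?p \<le> (1 + ?y) / ?R")
proof (rule min_one_exp_le)
  interpret product_prob_space "\<lambda>_. normal_law 0 1" I
    by (rule product_prob_space_normal_law) simp
  have exp_diff': "exp (x - y) = exp (- y) * exp x" for x y :: real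
    by (simp add: exp_add[symmetric])
  define H where "H \<beta> = (\<Sum>j\<in>I. (\<beta> j - b j)\<^sup>2)" for \<beta>
  define m where "m v j = exp ((g j - b j)\<^sup>2 / (2 * (v + 1)) - (b j)\<^sup>2 / 2) / sqrt (v + 1)" for v j
  have tilt: "has_bochner_integral N
      (\<lambda>\<beta>. exp ((\<Sum>j\<in>I. g j * (\<beta> j - b j)) - v / 2 * H \<beta>)) (\<Prod>j\<in>I. m v j)" if "v > -1" for v
  proof -
    have "has_bochner_integral N
        (\<lambda>\<beta>. \<Prod>j\<in>I. exp (g j * (\<beta> j - b j) - v / 2 * (\<beta> j - b j)\<^sup>2)) (\<Prod>j\<in>I. m v j)"
      unfolding N_def m_def
      using std_normal_quadratic_tilt[OF that] by (intro has_bochner_integral_PiM_prod I)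
    then show ?thesis
      by (simp add: exp_sum[OF I, symmetric] sum_subtractf sum_distrib_left sum_divide_distrib H_def)
  qed
  have tiltI: "integrable N (\<lambda>\<beta>. exp ((\<Sum>j\<in>I. g j * (\<beta> j - b j)) - v / 2 * H \<beta>))"
    and tiltE: "(\<integral>\<beta>. exp ((\<Sum>j\<in>I. g j * (\<beta> j - b j)) - v / 2 * H \<beta>) \<partial>N) = (\<Prod>j\<in>I. m v j)"
    if "v > -1" for v
    using tilt[OF that] by (auto simp: has_bochner_integral_iff)
  have Lpos: "0 < L \<beta>" for \<beta> using K by (simp add: L_eq)
  have L_le: "L \<beta> \<le> K * exp ((\<Sum>j\<in>I. g j * (\<beta> j - b j)) - lam / 2 * H \<beta>)" for \<beta>
    using S_lower[of \<beta>] K by (simp add: L_eq H_def)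
  have L_int: "integrable N L"
  proof (rule Bochner_Integration.integrable_bound)
    show "integrable N (\<lambda>\<beta>. K * exp ((\<Sum>j\<in>I. g j * (\<beta> j - b j)) - lam / 2 * H \<beta>))"
      using tiltI[of lam] lam by auto
    show "AE \<beta> in N. norm (L \<beta>) \<le> norm (K * exp ((\<Sum>j\<in>I. g j * (\<beta> j - b j)) - lam / 2 * H \<beta>))"
      using L_le Lpos K by (auto simp: less_imp_le abs_of_pos)
  qed fact
  have "K * (\<Prod>j\<in>I. m Lam j) = (\<integral>\<beta>. K * exp ((\<Sum>j\<in>I. g j * (\<beta> j - b j)) - Lam / 2 * H \<beta>) \<partial>N)"
    using tiltE[of Lam] lam by simp
  also have "\<dots> \<le> (\<integral>\<beta>. L \<beta> \<partial>N)"
  proof (rule integral_mono'[OF L_int])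
    show "K * exp ((\<Sum>j\<in>I. g j * (\<beta> j - b j)) - Lam / 2 * H \<beta>) \<le> L \<beta>" for \<beta>
      using S_upper[of \<beta>] K by (simp add: L_eq H_def)
  qed (use Lpos in \<open>simp add: less_imp_le\<close>)
  finally have den: "K * (\<Prod>j\<in>I. m Lam j) \<le> (\<integral>\<beta>. L \<beta> \<partial>N)" .
  have mpos: "0 < m v j" if "v > -1" for v j using that by (simp add: m_def)
  have m_prod_pos: "0 < (\<Prod>j\<in>I. m Lam j)" using lam mpos[of Lam] by (intro prod_pos) auto
  then have den_pos: "0 < (\<integral>\<beta>. L \<beta> \<partial>N)" using den K by (smt (verit) mult_pos_pos)
  have "(\<integral>\<beta>. ind \<beta> * L \<beta> \<partial>N) \<le> (\<integral>\<beta>. L \<beta> \<partial>N)"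
    using L_int Lpos ind by (intro integral_mono') (auto simp: less_imp_le mult_left_le_one_le)
  then show "?p \<le> 1" using den_pos by (simp add: divide_le_eq)

  \<comment> \<open>The Chernoff parameter: \<open>v + 1\<close> and \<open>lam - v\<close> both
    equal \<open>(lam + 1) / 2\<close>, which is the even split of the precision.\<close>
  define v where "v = (lam - 1) / 2"
  have v: "v > -1" "v + 1 = (lam + 1) / 2" using lam by (auto simp: v_def field_simps)
  have "ind \<beta> * L \<beta> \<le> K * exp (- ?R) * exp ((\<Sum>j\<in>I. g j * (\<beta> j - b j)) - v / 2 * H \<beta>)" for \<beta>
  proof (cases "ind \<beta> = 0")
    case False
    have "ind \<beta> * L \<beta> \<le> 1 * L \<beta>" using ind Lpos[of \<beta>] by (intro mult_right_mono) auto
    also have "\<dots> \<le> K * exp ((\<Sum>j\<in>I. g j * (\<beta> j - b j)) - lam / 2 * H \<beta>)" using L_le by simp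
    also have "\<dots> \<le> K * exp ((\<Sum>j\<in>I. g j * (\<beta> j - b j)) - v / 2 * H \<beta> - ?R)"
    proof -
      have "(lam + 1) / 4 * r \<le> (lam + 1) / 4 * H \<beta>"
        using ind_far[OF False] lam by (intro mult_left_mono) (auto simp: H_def)
      also have "(lam + 1) / 4 * H \<beta> = lam / 2 * H \<beta> - v / 2 * H \<beta>"
        by (simp add: v_def field_simps)
      finally show ?thesis using K by simp
    qed
    finally show ?thesis by (simp only: exp_diff' mult.assoc)
  qed (use K in simp)
  then have "(\<integral>\<beta>. ind \<beta> * L \<beta> \<partial>N)
      \<le> (\<integral>\<beta>. K * exp (- ?R) * exp ((\<Sum>j\<in>I. g j * (\<beta> j - b j)) - v / 2 * H \<beta>) \<partial>N)"
    using tiltI[OF v(1)] K by (intro integral_mono') auto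
  also have "\<dots> = K * exp (- ?R) * (\<Prod>j\<in>I. m v j)"
    using tiltE[OF v(1)] by simp
  finally have num: "(\<integral>\<beta>. ind \<beta> * L \<beta> \<partial>N) \<le> K * exp (- ?R) * (\<Prod>j\<in>I. m v j)" .
  \<comment> \<open>The terms in \<open>b j\<close> alone cancel, and the quadratic exponent of
    \<open>m Lam j\<close> only enlarges the right side. The 2 in \<open>2 * \<kappa>\<close> arises
    because \<open>v + 1\<close> is half of \<open>lam + 1\<close>.\<close>
  have "m v j \<le> exp ((g j - b j)\<^sup>2 / (lam + 1) + ln (2 * \<kappa>) / 2) * m Lam j" for j
  proof -
    have "sqrt (Lam + 1) \<le> sqrt (2 * \<kappa> * ((lam + 1) / 2))"
      using lam by simp
    also have "\<dots> = sqrt (2 * \<kappa>) * sqrt (v + 1)"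
      by (simp only: real_sqrt_mult v(2))
    also have "sqrt (2 * \<kappa>) = exp (ln (sqrt (2 * \<kappa>)))"
      using lam by simp
    also have "ln (sqrt (2 * \<kappa>)) = ln (2 * \<kappa>) / 2"
      using lam by (intro ln_sqrt) auto
    finally have "1 / sqrt (v + 1) \<le> exp (ln (2 * \<kappa>) / 2) * (1 / sqrt (Lam + 1))"
      using lam v(1) by (simp add: field_simps)
    moreover have "exp ((g j - b j)\<^sup>2 / (2 * (v + 1)) - (b j)\<^sup>2 / 2)
        \<le> exp ((g j - b j)\<^sup>2 / (lam + 1)) * exp ((g j - b j)\<^sup>2 / (2 * (Lam + 1)) - (b j)\<^sup>2 / 2)"
    proof -
      have "2 * (v + 1) = lam + 1" using v(2) by simp
      then show ?thesis using lam by (simp add: exp_add[symmetric] del: distrib_left_numeral)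
    qed
    ultimately have "exp ((g j - b j)\<^sup>2 / (2 * (v + 1)) - (b j)\<^sup>2 / 2) * (1 / sqrt (v + 1))
      \<le> (exp ((g j - b j)\<^sup>2 / (lam + 1)) * exp ((g j - b j)\<^sup>2 / (2 * (Lam + 1)) - (b j)\<^sup>2 / 2))
         * (exp (ln (2 * \<kappa>) / 2) * (1 / sqrt (Lam + 1)))"
      using v(1) by (intro mult_mono) simp_all
    then show ?thesis by (simp add: m_def exp_add mult_ac)
  qed
  then have "(\<Prod>j\<in>I. m v j)
      \<le> (\<Prod>j\<in>I. exp ((g j - b j)\<^sup>2 / (lam + 1) + ln (2 * \<kappa>) / 2) * m Lam j)"
    using mpos[OF v(1)] by (intro prod_mono) (auto simp: less_imp_le)
  also have "\<dots> = exp ?y * (\<Prod>j\<in>I. m Lam j)"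
    by (simp add: prod.distrib exp_sum[OF I, symmetric] sum.distrib sum_divide_distrib)
  finally have "(\<integral>\<beta>. ind \<beta> * L \<beta> \<partial>N) \<le> K * exp (- ?R) * (exp ?y * (\<Prod>j\<in>I. m Lam j))"
    using num K by (smt (verit) exp_gt_zero mult_left_mono mult_pos_pos)
  also have "\<dots> = exp (?y - ?R) * (K * (\<Prod>j\<in>I. m Lam j))"
    by (simp only: exp_diff' mult_ac)
  also have "\<dots> \<le> exp (?y - ?R) * (\<integral>\<beta>. L \<beta> \<partial>N)"
    using den by simp
  finally show "?p \<le> exp (?y - ?R)" using den_pos by (simp add: divide_le_eq)
  show "0 \<le> ?y" using lam by (auto intro!: add_nonneg_nonneg divide_nonneg_nonneg sum_nonneg)
  show "0 < ?R" using lam r by auto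
qed

section \<open>Design sums, the spline likelihood and the posterior in terms of coefficients\<close>

lemma design_norm_eq:
  assumes "1 \<le> n"
  shows "design_norm z n f = sqrt ((\<Sum>i=1..n. (f (z i))\<^sup>2) / real n)"
  using assms unfolding design_norm_def design_measure_def
  by (simp add: integral_map_pmf integral_pmf_of_set)

text \<open>This turns the Gram condition into bounds on the sum of squared spline values at the
  design points, which is also the quadratic part of the log-likelihood.\<close>

lemma design_gram_quadratic_form:
  assumes "1 \<le> n"
  shows "(\<Sum>i=1..J. \<Sum>j=1..J. \<beta> i * design_gram z n q t i j * \<beta> j)
    = (\<Sum>k=1..n. (spline_fun q t J \<beta> (z k))\<^sup>2) / real n"
proof -
  have "design_gram z n q t i j = (\<Sum>k=1..n. bspline t q i (z k) * bspline t q j (z k)) / real n" for i j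
    using assms unfolding design_gram_def design_measure_def
    by (simp add: integral_map_pmf integral_pmf_of_set)
  then have "(\<Sum>i=1..J. \<Sum>j=1..J. \<beta> i * design_gram z n q t i j * \<beta> j)
     = (\<Sum>i=1..J. \<Sum>j=1..J. \<Sum>k=1..n. (\<beta> i * bspline t q i (z k)) * (\<beta> j * bspline t q j (z k)) / real n)"
    by (simp add: sum_distrib_left sum_distrib_right sum_divide_distrib mult_ac)
  also have "\<dots> = (\<Sum>i=1..J. \<Sum>k=1..n. \<Sum>j=1..J. (\<beta> i * bspline t q i (z k)) * (\<beta> j * bspline t q j (z k)) / real n)"
    by (intro sum.cong refl sum.swap)
  also have "\<dots> = (\<Sum>k=1..n. \<Sum>i=1..J. \<Sum>j=1..J. (\<beta> i * bspline t q i (z k)) * (\<beta> j * bspline t q j (z k)) / real n)"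
    by (rule sum.swap)
  also have "\<dots> = (\<Sum>k=1..n. (spline_fun q t J \<beta> (z k))\<^sup>2) / real n"
    by (simp add: spline_fun_def power2_eq_square sum_product sum_divide_distrib)
  finally show ?thesis .
qed

lemma spline_fun_diff:
  "spline_fun q t J (\<lambda>j. \<beta> j - b j) x = spline_fun q t J \<beta> x - spline_fun q t J b x"
  by (simp add: spline_fun_def left_diff_distrib sum_subtractf)

text \<open>The log-likelihood is quadratic in the values of the spline, and these are linear in the
  coefficients, so its second-order expansion at \<open>b\<close> is exact. The linear coefficients
  form the score at \<open>b\<close>.\<close>

lemma regression_likelihood_spline:
  assumes "0 < \<sigma>"
  shows "regression_likelihood z \<sigma> n (spline_fun q t J \<beta>) X
    = regression_likelihood z \<sigma> n (spline_fun q t J b) X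
      * exp ((\<Sum>j=1..J. (\<Sum>i=1..n. (X i - spline_fun q t J b (z i)) * bspline t q j (z i)) / \<sigma>\<^sup>2
                * (\<beta> j - b j))
             - (\<Sum>i=1..n. (spline_fun q t J (\<lambda>j. \<beta> j - b j) (z i))\<^sup>2) / (2 * \<sigma>\<^sup>2))"
proof -
  let ?b = "\<lambda>i. spline_fun q t J b (z i)" and ?v = "\<lambda>i. spline_fun q t J (\<lambda>j. \<beta> j - b j) (z i)"
  have "(\<Sum>j=1..J. (\<Sum>i=1..n. (X i - ?b i) * bspline t q j (z i)) / \<sigma>\<^sup>2 * (\<beta> j - b j))
     = (\<Sum>j=1..J. \<Sum>i=1..n. (X i - ?b i) * ((\<beta> j - b j) * bspline t q j (z i)) / \<sigma>\<^sup>2)"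
    by (simp add: sum_divide_distrib sum_distrib_right sum_distrib_left mult_ac)
  also have "\<dots> = (\<Sum>i=1..n. \<Sum>j=1..J. (X i - ?b i) * ((\<beta> j - b j) * bspline t q j (z i)) / \<sigma>\<^sup>2)"
    by (rule sum.swap)
  also have "\<dots> = (\<Sum>i=1..n. (X i - ?b i) * ?v i / \<sigma>\<^sup>2)"
    by (simp add: spline_fun_def sum_distrib_left sum_divide_distrib)
  finally have 1: "(\<Sum>j=1..J. (\<Sum>i=1..n. (X i - ?b i) * bspline t q j (z i)) / \<sigma>\<^sup>2 * (\<beta> j - b j))
     - (\<Sum>i=1..n. (?v i)\<^sup>2) / (2 * \<sigma>\<^sup>2)
     = (\<Sum>i=1..n. (X i - ?b i) * ?v i / \<sigma>\<^sup>2 - (?v i)\<^sup>2 / (2 * \<sigma>\<^sup>2))"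
    by (simp add: sum_subtractf sum_divide_distrib)
  have "normal_density (spline_fun q t J \<beta> (z i)) \<sigma> (X i)
     = normal_density (?b i) \<sigma> (X i) * exp ((X i - ?b i) * ?v i / \<sigma>\<^sup>2 - (?v i)\<^sup>2 / (2 * \<sigma>\<^sup>2))" for i
  proof -
    have "- (X i - spline_fun q t J \<beta> (z i))\<^sup>2 / (2 * \<sigma>\<^sup>2)
       = - (X i - ?b i)\<^sup>2 / (2 * \<sigma>\<^sup>2) + ((X i - ?b i) * ?v i / \<sigma>\<^sup>2 - (?v i)\<^sup>2 / (2 * \<sigma>\<^sup>2))"
      using assms by (simp add: spline_fun_diff field_simps power2_eq_square)
    then show ?thesis by (simp add: normal_density_def exp_add[symmetric])
  qed
  then show ?thesis
    unfolding regression_likelihood_def 1 exp_sum[OF finite_atLeastAtMost] by (simp add: prod.distrib)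
qed

lemma measurable_regression_likelihood [measurable]:
  "(\<lambda>f. regression_likelihood z \<sigma> n f X) \<in> borel_measurable (PiM UNIV (\<lambda>_. borel))"
  unfolding regression_likelihood_def normal_density_def by measurable

lemma measurable_spline_fun [measurable]:
  "spline_fun q t J \<in> measurable (PiM {1..J} (\<lambda>_. normal_law 0 1)) (PiM UNIV (\<lambda>_. borel))"
proof (rule measurable_PiM_single')
  show "(\<lambda>\<beta>. spline_fun q t J \<beta> x) \<in> measurable (PiM {1..J} (\<lambda>_. normal_law 0 1)) borel" for x
    unfolding spline_fun_def by measurable
qed auto

lemma posterior_spline_prior:
  assumes [measurable]: "A \<in> sets (PiM UNIV (\<lambda>_. borel))"
  shows "posterior z \<sigma> n (spline_prior q t J) X A
    = (\<integral>\<beta>. indicator A (spline_fun q t J \<beta>) * regression_likelihood z \<sigma> n (spline_fun q t J \<beta>) X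
          \<partial>PiM {1..J} (\<lambda>_. normal_law 0 1))
      / (\<integral>\<beta>. regression_likelihood z \<sigma> n (spline_fun q t J \<beta>) X \<partial>PiM {1..J} (\<lambda>_. normal_law 0 1))"
  unfolding posterior_def spline_prior_def
  by (intro arg_cong2[where f="(/)"] integral_distr) measurable

lemma sets_design_norm_ge:
  assumes "1 \<le> n"
  shows "{f. design_norm z n (\<lambda>x. f x - f0 x) \<ge> e} \<in> sets (PiM UNIV (\<lambda>_. borel))"
proof -
  have "{f \<in> space (PiM UNIV (\<lambda>_::real. borel :: real measure)).
           sqrt ((\<Sum>i=1..n. (f (z i) - f0 (z i))\<^sup>2) / real n) \<ge> e} \<in> sets (PiM UNIV (\<lambda>_. borel))"
    by measurable
  then show ?thesis by (simp add: design_norm_eq[OF assms] space_PiM)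
qed

text \<open>A matrix and its transpose have the same operator norm. With \<open>w\<close> the
  transpose applied to \<open>d\<close> and \<open>u\<close> the matrix applied to \<open>w\<close>,
  the square of \<open>w\<close> is the inner product of \<open>d\<close> and \<open>u\<close>;
  weighted AM-GM and the bound at \<open>w\<close> allow half of that square to be absorbed.\<close>

lemma sum_square_transpose_le:
  fixes T :: "'i \<Rightarrow> 'j \<Rightarrow> real"
  assumes fin: "finite I" "finite K" and A: "0 < A"
    and bound: "\<And>\<beta>. (\<Sum>i\<in>I. (\<Sum>j\<in>K. \<beta> j * T i j)\<^sup>2) \<le> A * (\<Sum>j\<in>K. (\<beta> j)\<^sup>2)"
  shows "(\<Sum>j\<in>K. (\<Sum>i\<in>I. d i * T i j)\<^sup>2) \<le> A * (\<Sum>i\<in>I. (d i)\<^sup>2)"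
proof -
  define w where "w j = (\<Sum>i\<in>I. d i * T i j)" for j
  define u where "u i = (\<Sum>j\<in>K. w j * T i j)" for i
  have "(\<Sum>j\<in>K. (w j)\<^sup>2) = (\<Sum>j\<in>K. \<Sum>i\<in>I. d i * (w j * T i j))"
    by (simp add: power2_eq_square sum_distrib_left w_def mult_ac)
  also have "\<dots> = (\<Sum>i\<in>I. d i * u i)"
    by (subst sum.swap) (simp add: u_def sum_distrib_left)
  also have "\<dots> \<le> (\<Sum>i\<in>I. A / 2 * (d i)\<^sup>2 + (u i)\<^sup>2 / (2 * A))"
  proof (rule sum_mono)
    fix i
    have "0 \<le> (A * d i - u i)\<^sup>2 / (2 * A)" using A by simp
    also have "\<dots> = A / 2 * (d i)\<^sup>2 + (u i)\<^sup>2 / (2 * A) - d i * u i"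
      using A by (simp add: power2_eq_square field_simps)
    finally show "d i * u i \<le> A / 2 * (d i)\<^sup>2 + (u i)\<^sup>2 / (2 * A)" by simp
  qed
  also have "\<dots> = A / 2 * (\<Sum>i\<in>I. (d i)\<^sup>2) + (\<Sum>i\<in>I. (u i)\<^sup>2) / (2 * A)"
    by (simp add: sum.distrib sum_distrib_left sum_divide_distrib)
  also have "\<dots> \<le> A / 2 * (\<Sum>i\<in>I. (d i)\<^sup>2) + (A * (\<Sum>j\<in>K. (w j)\<^sup>2)) / (2 * A)"
    using bound[of w] A by (intro add_left_mono divide_right_mono) (auto simp: u_def)
  finally show ?thesis using A by (simp add: w_def)
qed

section \<open>Expected posterior mass at a fixed sample size\<close>

lemma posterior_nonneg: "0 \<le> posterior z \<sigma> n prior X A"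
  unfolding posterior_def regression_likelihood_def
  by (intro divide_nonneg_nonneg Bochner_Integration.integral_nonneg mult_nonneg_nonneg prod_nonneg)
     (auto simp: indicator_def)

text \<open>The exponent gained by the Chernoff bound is at least \<open>\<rho> * real J\<close>.
  When \<delta> and the squared norm of \<open>b\<close> are of order \<open>J\<close>, so is the
  numerator, and the bound becomes a constant over \<rho>.\<close>

lemma expected_posterior_far_mass:
  fixes z t :: "nat \<Rightarrow> real" and c C \<sigma> e \<rho> :: real and q J n :: nat
  defines "B \<equiv> \<lambda>\<beta> i. spline_fun q t J \<beta> (z i)"
  assumes \<sigma>: "0 < \<sigma>" and n: "1 \<le> n" and J: "1 \<le> J" and cC: "0 < c" "0 < C"
    and gram_lower: "\<And>\<beta>. c * (real n / real J) * (\<Sum>j=1..J. (\<beta> j)\<^sup>2) \<le> (\<Sum>i=1..n. (B \<beta> i)\<^sup>2)"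
    and gram_upper: "\<And>\<beta>. (\<Sum>i=1..n. (B \<beta> i)\<^sup>2) \<le> C * (real n / real J) * (\<Sum>j=1..J. (\<beta> j)\<^sup>2)"
    and \<delta>: "(\<Sum>i=1..n. (f0 (z i) - B b i)\<^sup>2) \<le> \<delta>"
    and \<rho>: "0 < \<rho>" "\<rho> * real J \<le> c / (4 * C * \<sigma>\<^sup>2) * (real n * e\<^sup>2 / 2 - \<delta>)" and e: "0 \<le> e"
  shows "(\<integral>X. posterior z \<sigma> n (spline_prior q t J) X {f. design_norm z n (\<lambda>x. f x - f0 x) \<ge> e}
            \<partial>regression_law z \<sigma> n f0)
     \<le> (1 + (C / c * real J + 2 * C / (c * \<sigma>\<^sup>2) * \<delta> + 2 * (\<Sum>j=1..J. (b j)\<^sup>2)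
             + real J * (ln (2 * (1 + C / c)) / 2))) / (\<rho> * real J)"
proof -
  define A where "A = real n / real J"
  have A: "0 < A" using n J by (simp add: A_def)
  define lam Lam where "lam = c * A / \<sigma>\<^sup>2" and "Lam = C * A / \<sigma>\<^sup>2"
  have lam: "0 < lam" "0 < Lam" using cC A \<sigma> by (auto simp: lam_def Lam_def)
  have "C / c * lam = Lam" using cC by (simp add: lam_def Lam_def)
  \<comment> \<open>\<open>1 + C / c\<close> bounds the ratio of the two precisions without a case
    distinction on \<open>C / c\<close>, and it is free of \<open>n\<close> and
    \<open>J\<close>.\<close>
  then have \<kappa>: "Lam + 1 \<le> (1 + C / c) * (lam + 1)"
    using cC lam by (simp add: algebra_simps add_divide_distrib)
  define d where "d i = f0 (z i) - B b i" for i
  define g where "g X j = (\<Sum>i=1..n. (X i - B b i) * bspline t q j (z i)) / \<sigma>\<^sup>2" for X j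
  define k where "k = ln (2 * (1 + C / c)) / 2"
  \<comment> \<open>The squared coefficient distance from \<open>b\<close> forced by a design
    distance of at least \<open>e\<close> from \<open>f0\<close>: by
    \<open>(v - d)\<^sup>2 \<le> 2 * v\<^sup>2 + 2 * d\<^sup>2\<close> and the upper Gram bound,
    \<open>real n * e\<^sup>2\<close> is at most \<open>2 * C * A\<close> times that distance plus
    \<open>2 * \<delta>\<close>.\<close>
  define r where "r = (real n * e\<^sup>2 / 2 - \<delta>) / (C * A)"
  have R: "\<rho> * real J \<le> (lam + 1) / 4 * r"
  proof -
    have "c / (4 * C * \<sigma>\<^sup>2) * (real n * e\<^sup>2 / 2 - \<delta>) = lam / 4 * r"
      using cC A \<sigma> by (simp add: lam_def r_def)
    then have le: "\<rho> * real J \<le> lam / 4 * r" using \<rho>(2) by (simp only:)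
    have "0 < \<rho> * real J" using \<rho> J by simp
    then have "0 < lam / 4 * r" using le by linarith
    then have "0 < r" using lam by (simp add: zero_less_mult_iff)
    with le show ?thesis by (simp add: algebra_simps)
  qed
  have \<rho>J: "0 < \<rho> * real J" using \<rho> J by simp
  have r: "0 < r"
  proof -
    have "0 < (lam + 1) / 4 * r" using R \<rho>J by linarith
    then show ?thesis using lam by (simp add: zero_less_mult_iff)
  qed
  define F where "F = {f. design_norm z n (\<lambda>x. f x - f0 x) \<ge> e}"
  have far: "r \<le> (\<Sum>j=1..J. (\<beta> j - b j)\<^sup>2)" if "spline_fun q t J \<beta> \<in> F" for \<beta>
  proof -
    let ?v = "B (\<lambda>j. \<beta> j - b j)"
    have "e \<le> sqrt ((\<Sum>i=1..n. (B \<beta> i - f0 (z i))\<^sup>2) / real n)"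
      using that by (simp add: F_def design_norm_eq[OF n] B_def)
    then have "e\<^sup>2 \<le> (\<Sum>i=1..n. (B \<beta> i - f0 (z i))\<^sup>2) / real n"
      using e by (simp add: real_le_rsqrt sqrt_ge_absD)
    then have "real n * e\<^sup>2 \<le> (\<Sum>i=1..n. (B \<beta> i - f0 (z i))\<^sup>2)"
      using n by (simp add: field_simps)
    also have "\<dots> \<le> (\<Sum>i=1..n. 2 * (?v i)\<^sup>2 + 2 * (d i)\<^sup>2)"
    proof (rule sum_mono)
      fix i
      have "B \<beta> i - f0 (z i) = ?v i - d i" by (simp add: B_def spline_fun_diff d_def)
      moreover have "(?v i - d i)\<^sup>2 \<le> 2 * (?v i)\<^sup>2 + 2 * (d i)\<^sup>2"
        using zero_le_power2[of "?v i + d i"] by (simp add: power2_eq_square algebra_simps)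
      ultimately show "(B \<beta> i - f0 (z i))\<^sup>2 \<le> 2 * (?v i)\<^sup>2 + 2 * (d i)\<^sup>2" by simp
    qed
    also have "\<dots> \<le> 2 * (C * A * (\<Sum>j=1..J. (\<beta> j - b j)\<^sup>2)) + 2 * \<delta>"
      using gram_upper[of "\<lambda>j. \<beta> j - b j"] \<delta>
      by (simp add: sum.distrib sum_distrib_left[symmetric] A_def d_def)
    finally show ?thesis using cC A by (simp add: r_def field_simps)
  qed
  have [measurable]: "F \<in> sets (PiM UNIV (\<lambda>_. borel))"
    unfolding F_def by (rule sets_design_norm_ge[OF n])
  define Y where "Y X = (\<Sum>j=1..J. (g X j - b j)\<^sup>2) / (lam + 1)" for X
  have Y_nonneg: "0 \<le> Y X" for X using lam by (auto simp: Y_def intro!: divide_nonneg_nonneg sum_nonneg)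
  have k: "0 \<le> k" using cC by (simp add: k_def)
  have post_le: "posterior z \<sigma> n (spline_prior q t J) X F \<le> (1 + (Y X + real J * k)) / (\<rho> * real J)" for X
  proof -
    have "posterior z \<sigma> n (spline_prior q t J) X F
       \<le> (1 + ((\<Sum>j=1..J. (g X j - b j)\<^sup>2) / (lam + 1) + real (card {1..J}) * (ln (2 * (1 + C / c)) / 2)))
          / ((lam + 1) / 4 * r)"
      unfolding posterior_spline_prior[OF \<open>F \<in> _\<close>]
    proof (rule gaussian_prior_posterior_bound[where L = "\<lambda>\<beta>. regression_likelihood z \<sigma> n (spline_fun q t J \<beta>) X"
          and S = "\<lambda>\<beta>. (\<Sum>i=1..n. (B (\<lambda>j. \<beta> j - b j) i)\<^sup>2) / (2 * \<sigma>\<^sup>2)"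
          and K = "regression_likelihood z \<sigma> n (spline_fun q t J b) X"
          and ind = "\<lambda>\<beta>. indicator F (spline_fun q t J \<beta>)" and lam = lam and Lam = Lam])
      show "0 < regression_likelihood z \<sigma> n (spline_fun q t J b) X"
        unfolding regression_likelihood_def using \<sigma> by (intro prod_pos normal_density_pos)
      show "regression_likelihood z \<sigma> n (spline_fun q t J \<beta>) X
          = regression_likelihood z \<sigma> n (spline_fun q t J b) X
            * exp ((\<Sum>j=1..J. g X j * (\<beta> j - b j))
                - (\<Sum>i=1..n. (B (\<lambda>j. \<beta> j - b j) i)\<^sup>2) / (2 * \<sigma>\<^sup>2))" for \<beta>
        unfolding g_def B_def by (rule regression_likelihood_spline[OF \<sigma>])
      show "lam / 2 * (\<Sum>j=1..J. (\<beta> j - b j)\<^sup>2) \<le> (\<Sum>i=1..n. (B (\<lambda>j. \<beta> j - b j) i)\<^sup>2) / (2 * \<sigma>\<^sup>2)" for \<beta>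
        using divide_right_mono[OF gram_lower[of "\<lambda>j. \<beta> j - b j"], of "2 * \<sigma>\<^sup>2"]
        by (simp add: lam_def A_def mult_ac)
      show "(\<Sum>i=1..n. (B (\<lambda>j. \<beta> j - b j) i)\<^sup>2) / (2 * \<sigma>\<^sup>2) \<le> Lam / 2 * (\<Sum>j=1..J. (\<beta> j - b j)\<^sup>2)" for \<beta>
        using divide_right_mono[OF gram_upper[of "\<lambda>j. \<beta> j - b j"], of "2 * \<sigma>\<^sup>2"]
        by (simp add: Lam_def A_def mult_ac)
      show "(\<lambda>\<beta>. regression_likelihood z \<sigma> n (spline_fun q t J \<beta>) X)
          \<in> borel_measurable (PiM {1..J} (\<lambda>_. normal_law 0 1))"
        by measurable
    qed (use lam \<kappa> cC r far in \<open>auto simp: indicator_def split: if_splits\<close>)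
    also have "\<dots> = (1 + (Y X + real J * k)) / ((lam + 1) / 4 * r)"
      by (simp add: Y_def k_def)
    also have "\<dots> \<le> (1 + (Y X + real J * k)) / (\<rho> * real J)"
      using R \<rho>J Y_nonneg[of X] k by (intro divide_left_mono) auto
    finally show ?thesis .
  qed
  \<comment> \<open>Splitting \<open>X i - B b i\<close> into noise plus \<open>d i\<close> shows
    that \<open>m j\<close> is the mean of \<open>g X j - b j\<close> under the true law;
    \<open>EY\<close> then adds variances and squared means.\<close>
  define m where "m j = (\<Sum>i=1..n. d i * bspline t q j (z i)) / \<sigma>\<^sup>2 - b j" for j
  define EY where "EY = (\<Sum>j=1..J. \<sigma>\<^sup>2 * (\<Sum>i=1..n. (bspline t q j (z i) / \<sigma>\<^sup>2)\<^sup>2) + (m j)\<^sup>2) / (lam + 1)"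
  have Y_int: "has_bochner_integral (regression_law z \<sigma> n f0) Y EY"
  proof -
    have "has_bochner_integral (regression_law z \<sigma> n f0)
      (\<lambda>X. (\<Sum>j=1..J. ((\<Sum>i=1..n. bspline t q j (z i) / \<sigma>\<^sup>2 * (X i - f0 (z i))) + m j)\<^sup>2) / (lam + 1)) EY"
      unfolding regression_law_eq_PiM[OF \<sigma>] EY_def using lam
      by (intro has_bochner_integral_divide has_bochner_integral_sum
          normal_linear_form_second_moment \<sigma>) auto
    moreover have "(\<Sum>i=1..n. bspline t q j (z i) / \<sigma>\<^sup>2 * (X i - f0 (z i))) + m j = g X j - b j" for X j
    proof -
      have "(\<Sum>i=1..n. bspline t q j (z i) / \<sigma>\<^sup>2 * (X i - f0 (z i)))
          + (\<Sum>i=1..n. d i * bspline t q j (z i)) / \<sigma>\<^sup>2 = g X j"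
        unfolding g_def sum_divide_distrib sum.distrib[symmetric]
        using \<sigma> by (intro sum.cong) (auto simp: d_def field_simps)
      then show ?thesis unfolding m_def by linarith
    qed
    ultimately show ?thesis by (simp add: Y_def[abs_def])
  qed
  have EY_le: "EY \<le> C / c * real J + 2 * C / (c * \<sigma>\<^sup>2) * \<delta> + 2 * (\<Sum>j=1..J. (b j)\<^sup>2)"
  proof -
    \<comment> \<open>The upper Gram bound at the j-th unit vector. Summing over \<open>j\<close>
      bounds the trace, that is, the total variance of the score.\<close>
    have "(\<Sum>i=1..n. (bspline t q j (z i))\<^sup>2) \<le> C * A" if "j \<in> {1..J}" for j
      using gram_upper[of "\<lambda>l. if l = j then 1 else 0"] that
      by (simp add: B_def spline_fun_def A_def if_distrib[of "\<lambda>x. x * _"] if_distrib[of "\<lambda>x. x\<^sup>2"]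
          sum.delta cong: if_cong)
    then have "(\<Sum>j=1..J. \<Sum>i=1..n. (bspline t q j (z i))\<^sup>2) \<le> real (card {1..J}) * (C * A)"
      by (intro sum_bounded_above) auto
    then have "(\<Sum>j=1..J. \<Sum>i=1..n. (bspline t q j (z i))\<^sup>2) / \<sigma>\<^sup>2 \<le> real J * (C * A) / \<sigma>\<^sup>2"
      by (intro divide_right_mono) auto
    also have "(\<Sum>j=1..J. \<Sum>i=1..n. (bspline t q j (z i))\<^sup>2) / \<sigma>\<^sup>2
        = (\<Sum>j=1..J. \<sigma>\<^sup>2 * (\<Sum>i=1..n. (bspline t q j (z i) / \<sigma>\<^sup>2)\<^sup>2))"
      unfolding sum_divide_distrib sum_distrib_left using \<sigma>
      by (intro sum.cong) (auto simp: power2_eq_square)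
    also have "real J * (C * A) / \<sigma>\<^sup>2 = C / c * real J * lam"
      using cC by (simp add: lam_def)
    finally have 1: "(\<Sum>j=1..J. \<sigma>\<^sup>2 * (\<Sum>i=1..n. (bspline t q j (z i) / \<sigma>\<^sup>2)\<^sup>2))
        \<le> C / c * real J * lam" .
    \<comment> \<open>The bias of the score is the transposed design matrix applied to the
      approximation error \<open>d\<close>. The operator norm bound avoids the factor
      \<open>J\<close> that a coordinatewise Cauchy-Schwarz estimate would cost.\<close>
    have "(\<Sum>j=1..J. (\<Sum>i=1..n. d i * bspline t q j (z i))\<^sup>2) \<le> C * A * (\<Sum>i=1..n. (d i)\<^sup>2)"
    proof (rule sum_square_transpose_le)
      show "(\<Sum>i=1..n. (\<Sum>j=1..J. \<beta> j * bspline t q j (z i))\<^sup>2) \<le> C * A * (\<Sum>j=1..J. (\<beta> j)\<^sup>2)" for \<beta>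
        using gram_upper[of \<beta>] by (simp only: B_def spline_fun_def A_def)
    qed (use cC A in auto)
    also have "\<dots> \<le> C * A * \<delta>" using \<delta> cC A by (intro mult_left_mono) (auto simp: d_def)
    finally have w: "(\<Sum>j=1..J. (\<Sum>i=1..n. d i * bspline t q j (z i))\<^sup>2) \<le> C * A * \<delta>" .
    have "(\<Sum>j=1..J. (m j)\<^sup>2)
       \<le> (\<Sum>j=1..J. 2 * ((\<Sum>i=1..n. d i * bspline t q j (z i)) / \<sigma>\<^sup>2)\<^sup>2 + 2 * (b j)\<^sup>2)"
    proof (rule sum_mono)
      fix j
      show "(m j)\<^sup>2 \<le> 2 * ((\<Sum>i=1..n. d i * bspline t q j (z i)) / \<sigma>\<^sup>2)\<^sup>2 + 2 * (b j)\<^sup>2"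
        using zero_le_power2[of "(\<Sum>i=1..n. d i * bspline t q j (z i)) / \<sigma>\<^sup>2 + b j"]
        unfolding m_def by (simp add: power2_sum power2_diff)
    qed
    also have "\<dots> = 2 / (\<sigma>\<^sup>2)\<^sup>2 * (\<Sum>j=1..J. (\<Sum>i=1..n. d i * bspline t q j (z i))\<^sup>2)
        + 2 * (\<Sum>j=1..J. (b j)\<^sup>2)"
      by (simp add: sum.distrib sum_distrib_left power_divide)
    also have "\<dots> \<le> 2 / (\<sigma>\<^sup>2)\<^sup>2 * (C * A * \<delta>) + 2 * (\<Sum>j=1..J. (b j)\<^sup>2)"
      using w by (intro add_right_mono mult_left_mono) auto
    also have "2 / (\<sigma>\<^sup>2)\<^sup>2 * (C * A * \<delta>) = 2 * C / (c * \<sigma>\<^sup>2) * \<delta> * lam"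
      using cC \<sigma> by (simp add: lam_def power2_eq_square)
    finally have 2: "(\<Sum>j=1..J. (m j)\<^sup>2) \<le> 2 * C / (c * \<sigma>\<^sup>2) * \<delta> * lam + 2 * (\<Sum>j=1..J. (b j)\<^sup>2)" .
    have "0 \<le> (\<Sum>i=1..n. (f0 (z i) - B b i)\<^sup>2)" by (intro sum_nonneg) auto
    then have "0 \<le> \<delta>" using \<delta> by linarith
    then have 3: "0 \<le> C / c * real J" "0 \<le> 2 * C / (c * \<sigma>\<^sup>2) * \<delta>" "0 \<le> 2 * (\<Sum>j=1..J. (b j)\<^sup>2) * lam"
      using cC \<sigma> lam by (auto intro!: sum_nonneg mult_nonneg_nonneg)
    \<comment> \<open>The variance and approximation terms carry a factor \<open>lam\<close>, the
      prior term a factor 1; each factor is at most \<open>lam + 1\<close>, the denominator of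
      \<open>EY\<close>.\<close>
    have "(\<Sum>j=1..J. \<sigma>\<^sup>2 * (\<Sum>i=1..n. (bspline t q j (z i) / \<sigma>\<^sup>2)\<^sup>2) + (m j)\<^sup>2)
       \<le> (C / c * real J + 2 * C / (c * \<sigma>\<^sup>2) * \<delta> + 2 * (\<Sum>j=1..J. (b j)\<^sup>2)) * (lam + 1)"
      unfolding sum.distrib distrib_left distrib_right mult_1_right using 1 2 3 by linarith
    then show ?thesis unfolding EY_def using lam by (simp add: divide_le_eq)
  qed
  interpret law: prob_space "regression_law z \<sigma> n f0"
    unfolding regression_law_eq_PiM[OF \<sigma>]
    by (intro prob_space_PiM prob_space_normal_density \<sigma>)
  have bound_int: "has_bochner_integral (regression_law z \<sigma> n f0)
      (\<lambda>X. (1 + (Y X + real J * k)) / (\<rho> * real J)) ((1 + (EY + real J * k)) / (\<rho> * real J))"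
    using \<rho>J Y_int law.prob_space
    by (intro has_bochner_integral_divide has_bochner_integral_add)
       (auto simp: has_bochner_integral_iff)
  \<comment> \<open>Measurability of the posterior in \<open>X\<close> is not needed: a non-integrable integrand would have
    Bochner integral \<open>0\<close>, and the upper bound is integrable and nonnegative.\<close>
  have "(\<integral>X. posterior z \<sigma> n (spline_prior q t J) X F \<partial>regression_law z \<sigma> n f0)
     \<le> (\<integral>X. (1 + (Y X + real J * k)) / (\<rho> * real J) \<partial>regression_law z \<sigma> n f0)"
    using bound_int post_le order_trans[OF posterior_nonneg post_le]
    by (intro integral_mono') (auto simp only: has_bochner_integral_iff)
  also have "\<dots> = (1 + (EY + real J * k)) / (\<rho> * real J)"
    using bound_int by (rule has_bochner_integral_integral_eq)
  also have "\<dots> \<le> (1 + (C / c * real J + 2 * C / (c * \<sigma>\<^sup>2) * \<delta> + 2 * (\<Sum>j=1..J. (b j)\<^sup>2)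
      + real J * k)) / (\<rho> * real J)"
    using EY_le \<rho>J by (intro divide_right_mono) auto
  finally show ?thesis by (simp add: F_def k_def)
qed

section \<open>Asymptotics and the convergence rate\<close>

lemma holder_class_continuous_on:
  assumes "f \<in> holder_class \<alpha>"
  shows "continuous_on {0..1} f"
proof (cases "holder_order \<alpha>")
  case 0
  then show ?thesis using assms by (simp add: holder_class_def C_k_01_def)
next
  case (Suc k)
  then have "deriv01 0 f differentiable_on {0..1}"
    using assms unfolding holder_class_def C_k_01_def by (metis (no_types, lifting) mem_Collect_eq zero_less_Suc)
  then show ?thesis by (simp add: differentiable_imp_continuous_on)
qed

lemma unif_norm_leD:
  assumes "unif_norm f \<le> ennreal c" "0 \<le> c" "x \<in> {0..1}"
  shows "\<bar>f x\<bar> \<le> c"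
proof -
  have "ennreal \<bar>f x\<bar> \<le> unif_norm f"
    unfolding unif_norm_def by (rule SUP_upper) fact
  then show ?thesis using assms by (metis ennreal_le_iff order_trans)
qed

theorem theorem12:
  fixes z :: "nat \<Rightarrow> nat \<Rightarrow> real" and \<sigma> \<alpha> :: real and q :: nat
    and t :: "nat \<Rightarrow> nat \<Rightarrow> real" and f\<^sub>0 :: "real \<Rightarrow> real" and J :: "nat \<Rightarrow> nat"
  assumes sigma_pos: "\<sigma> > 0"
    and design: "\<forall>n\<ge>1. \<forall>i\<in>{1..n}. z n i \<in> {0..1}"
    and alpha: "\<alpha> \<ge> 1/2" "\<alpha> \<le> real q"
    and knots: "\<forall>m\<ge>q. spline_knots q (m + 1 - q) (t m)"
    and f0_holder: "f\<^sub>0 \<in> holder_class \<alpha>"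
    and f0_approx: "\<exists>C>0. \<forall>m\<ge>q. \<exists>\<beta>.
          unif_norm (\<lambda>x. spline_fun q (t m) m \<beta> x - f\<^sub>0 x)
            \<le> ennreal (C * real m powr (-\<alpha>)) * holder_seminorm \<alpha> f\<^sub>0"
    and J_ge: "\<forall>n\<ge>1. J n \<ge> q"
    and gram: "\<exists>c>0. \<exists>C>0. \<forall>\<^sub>F n in sequentially. \<forall>\<beta> :: nat \<Rightarrow> real.
          c * (1 / real (J n)) * (\<Sum>j=1..J n. (\<beta> j)\<^sup>2)
            \<le> (\<Sum>i=1..J n. \<Sum>j=1..J n. \<beta> i * design_gram (z n) n q (t (J n)) i j * \<beta> j)
        \<and> (\<Sum>i=1..J n. \<Sum>j=1..J n. \<beta> i * design_gram (z n) n q (t (J n)) i j * \<beta> j)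
            \<le> C * (1 / real (J n)) * (\<Sum>j=1..J n. (\<beta> j)\<^sup>2)"
    and J_rate: "(\<lambda>n. real (J n)) \<in> \<Theta>(\<lambda>n. real n powr (1 / (1 + 2 * \<alpha>)))"
  shows "posterior_converges_at_rate z \<sigma> (\<lambda>n. spline_prior q (t (J n)) (J n)) f\<^sub>0
           (\<lambda>n. real n powr (- \<alpha> / (1 + 2 * \<alpha>)))"
  unfolding posterior_converges_at_rate_def
proof (intro allI impI)
  fix M :: "nat \<Rightarrow> real"
  assume M: "filterlim M at_top sequentially"
  define s where "s = 1 / (1 + 2 * \<alpha>)"
  define \<epsilon> where "\<epsilon> n = real n powr (- \<alpha> / (1 + 2 * \<alpha>))" for n
  have \<alpha>: "0 < \<alpha>" using alpha(1) by simp
  have rate: "real n * (\<epsilon> n)\<^sup>2 = real n powr s" if "1 \<le> n" for n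
  proof -
    have "(\<epsilon> n)\<^sup>2 = real n powr (2 * (- \<alpha> / (1 + 2 * \<alpha>)))"
      using that by (simp add: \<epsilon>_def power2_eq_square powr_add[symmetric])
    then have "real n * (\<epsilon> n)\<^sup>2 = real n powr (1 + 2 * (- \<alpha> / (1 + 2 * \<alpha>)))"
      by (simp only: powr_mult_base of_nat_0_le_iff)
    also have "1 + 2 * (- \<alpha> / (1 + 2 * \<alpha>)) = s"
      using \<alpha> by (simp add: s_def field_simps)
    finally show ?thesis .
  qed
  \<comment> \<open>Boundedness of the true function will control the coefficients of its spline
    approximation.\<close>
  obtain F0 where F0: "\<And>x. x \<in> {0..1} \<Longrightarrow> \<bar>f\<^sub>0 x\<bar> \<le> F0"
    using compact_continuous_image[OF holder_class_continuous_on[OF f0_holder] compact_Icc]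
    by (fastforce dest!: compact_imp_bounded simp: bounded_iff)
  have F0_nonneg: "0 \<le> F0"
    using F0[of 0] abs_ge_zero[of "f\<^sub>0 0"] by (auto intro: order_trans)
  obtain Ca where Ca: "0 < Ca" and approx: "\<And>m. m \<ge> q \<Longrightarrow> \<exists>\<beta>.
        unif_norm (\<lambda>x. spline_fun q (t m) m \<beta> x - f\<^sub>0 x)
          \<le> ennreal (Ca * real m powr (-\<alpha>)) * holder_seminorm \<alpha> f\<^sub>0"
    using f0_approx by blast
  define D where "D = Ca * enn2real (holder_seminorm \<alpha> f\<^sub>0)"
  have D: "0 \<le> D" using Ca by (simp add: D_def)
  \<comment> \<open>Membership in the Hoelder class makes the seminorm finite, so
    \<open>enn2real\<close> does not collapse an infinite value to 0.\<close>
  have seminorm: "holder_seminorm \<alpha> f\<^sub>0 = ennreal (enn2real (holder_seminorm \<alpha> f\<^sub>0))"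
    using f0_holder by (simp add: holder_class_def)
  have "\<exists>\<beta>. \<forall>x\<in>{0..1}. \<bar>spline_fun q (t m) m \<beta> x - f\<^sub>0 x\<bar> \<le> D * real m powr (-\<alpha>)" if m: "m \<ge> q" for m
  proof -
    obtain \<beta> where "unif_norm (\<lambda>x. spline_fun q (t m) m \<beta> x - f\<^sub>0 x)
          \<le> ennreal (Ca * real m powr (-\<alpha>)) * holder_seminorm \<alpha> f\<^sub>0"
      using approx[OF m] by blast
    also have "\<dots> = ennreal (D * real m powr (-\<alpha>))"
      by (subst seminorm) (use Ca in \<open>simp add: D_def ennreal_mult'[symmetric] mult_ac\<close>)
    finally show ?thesis using D unif_norm_leD by fastforce
  qed
  then obtain b where b: "\<And>m x. m \<ge> q \<Longrightarrow> x \<in> {0..1} \<Longrightarrow>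
      \<bar>spline_fun q (t m) m (b m) x - f\<^sub>0 x\<bar> \<le> D * real m powr (-\<alpha>)"
    by metis
  obtain c C where cC: "0 < c" "0 < C" and gramE: "\<forall>\<^sub>F n in sequentially. \<forall>\<beta> :: nat \<Rightarrow> real.
          c * (1 / real (J n)) * (\<Sum>j=1..J n. (\<beta> j)\<^sup>2)
            \<le> (\<Sum>i=1..J n. \<Sum>j=1..J n. \<beta> i * design_gram (z n) n q (t (J n)) i j * \<beta> j)
        \<and> (\<Sum>i=1..J n. \<Sum>j=1..J n. \<beta> i * design_gram (z n) n q (t (J n)) i j * \<beta> j)
            \<le> C * (1 / real (J n)) * (\<Sum>j=1..J n. (\<beta> j)\<^sup>2)"
    using gram by blast
  obtain C1 where C1: "0 < C1" "\<forall>\<^sub>F n in sequentially. real (J n) \<le> C1 * real n powr s"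
    using bigthetaD1[OF J_rate] by (elim landau_o.bigE) (auto simp: s_def)
  obtain c1 where c1: "0 < c1" "\<forall>\<^sub>F n in sequentially. c1 * real n powr s \<le> real (J n)"
    using bigthetaD2[OF J_rate] by (elim landau_omega.bigE) (auto simp: s_def)
  \<comment> \<open>\<open>D' * J\<close> will bound the squared approximation error summed over the
    design. \<open>E\<close> collects, per unit of \<open>J\<close>, the terms of the numerator: the
    constant 1, score variance, approximation error, prior centring and normalizing factors.
    \<open>\<rho> n\<close> is the exponent per unit of \<open>J\<close>, where
    \<open>J \<le> C1 * n powr s\<close> gives the \<open>2 * C1\<close>.\<close>
  define D' where "D' = D\<^sup>2 / c1 powr (1 + 2 * \<alpha>)"
  define E where "E = 1 + (C / c + 2 * C / (c * \<sigma>\<^sup>2) * D' + 2 * ((F0 + D)\<^sup>2 / c) + ln (2 * (1 + C / c)) / 2)"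
  define \<rho> where "\<rho> n = c / (4 * C * \<sigma>\<^sup>2) * ((M n)\<^sup>2 / (2 * C1) - D')" for n
  let ?p = "\<lambda>n. \<integral>X. posterior (z n) \<sigma> n (spline_prior q (t (J n)) (J n)) X
                   {f. design_norm (z n) n (\<lambda>x. f x - f\<^sub>0 x) \<ge> M n * \<epsilon> n}
              \<partial>regression_law (z n) \<sigma> n f\<^sub>0"
  have M2: "filterlim (\<lambda>n. (M n)\<^sup>2) at_top sequentially"
    using M by (intro filterlim_pow_at_top) auto
  then have "filterlim (\<lambda>n. - D' + (M n)\<^sup>2 * (1 / (2 * C1))) at_top sequentially"
    using C1 by (intro filterlim_tendsto_add_at_top[OF tendsto_const]
        filterlim_at_top_mult_tendsto_pos[OF tendsto_const]) auto
  then have "filterlim (\<lambda>n. (- D' + (M n)\<^sup>2 * (1 / (2 * C1))) * (c / (4 * C * \<sigma>\<^sup>2))) at_top sequentially"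
    using cC sigma_pos by (intro filterlim_at_top_mult_tendsto_pos[OF tendsto_const]) auto
  moreover have "(\<lambda>n. (- D' + (M n)\<^sup>2 * (1 / (2 * C1))) * (c / (4 * C * \<sigma>\<^sup>2))) = \<rho>"
    by (auto simp: \<rho>_def fun_eq_iff mult.commute)
  ultimately have \<rho>: "filterlim \<rho> at_top sequentially" by simp
  have bound: "\<forall>\<^sub>F n in sequentially. ?p n \<le> E / \<rho> n"
    \<comment> \<open>All ingredients hold for large \<open>n\<close> only; positivity of
      \<open>M n\<close> makes the radius \<open>M n * \<epsilon> n\<close> nonnegative.\<close>
    using gramE C1(2) c1(2) eventually_ge_at_top[of "1::nat"]
      filterlim_at_top_dense[THEN iffD1, OF \<rho>, rule_format, of 0]
      filterlim_at_top_dense[THEN iffD1, OF M, rule_format, of 0]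
  proof eventually_elim
    case (elim n)
    note n = elim(4) and \<rho>n = elim(5)
    let ?J = "real (J n)"
    let ?B = "\<lambda>\<beta> i. spline_fun q (t (J n)) (J n) \<beta> (z n i)"
    have "0 < c1 * real n powr s" using c1 n by simp
    then have Jpos: "0 < ?J" using elim(3) by linarith
    then have J1: "1 \<le> J n" "1 \<le> ?J" by auto
    have Jq: "J n \<ge> q" using J_ge n by simp
    have zn: "z n i \<in> {0..1}" if "i \<in> {1..n}" for i using design n that by blast
    have quad: "(\<Sum>i=1..J n. \<Sum>j=1..J n. \<beta> i * design_gram (z n) n q (t (J n)) i j * \<beta> j)
        = (\<Sum>i=1..n. (?B \<beta> i)\<^sup>2) / real n" for \<beta>
      by (rule design_gram_quadratic_form[OF n])
    have gl: "c * (real n / ?J) * (\<Sum>j=1..J n. (\<beta> j)\<^sup>2) \<le> (\<Sum>i=1..n. (?B \<beta> i)\<^sup>2)" for \<beta>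
      using elim(1)[rule_format, of \<beta>, THEN conjunct1] n unfolding quad by (simp add: field_simps)
    have gu: "(\<Sum>i=1..n. (?B \<beta> i)\<^sup>2) \<le> C * (real n / ?J) * (\<Sum>j=1..J n. (\<beta> j)\<^sup>2)" for \<beta>
      using elim(1)[rule_format, of \<beta>, THEN conjunct2] n unfolding quad by (simp add: field_simps)
    define \<delta> where "\<delta> = real n * (D * ?J powr (-\<alpha>))\<^sup>2"
    \<comment> \<open>Since \<open>s * (1 + 2 * \<alpha>) = 1\<close>, the lower bound on
      \<open>J\<close> says that \<open>n\<close> is at most a constant times
      \<open>J powr (1 + 2 * \<alpha>)\<close>. The factor \<open>J powr (- 2 * \<alpha>)\<close>
      from the squared error then leaves a single \<open>J\<close>.\<close>
    have \<delta>_le: "\<delta> \<le> D' * ?J"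
    proof -
      have "c1 powr (1 + 2 * \<alpha>) * real n = (c1 * real n powr s) powr (1 + 2 * \<alpha>)"
        using c1 \<alpha> n by (simp add: powr_mult powr_powr s_def)
      also have "\<dots> \<le> ?J powr (1 + 2 * \<alpha>)"
        using elim(3) c1 \<alpha> by (intro powr_mono2) auto
      finally have "real n \<le> ?J powr (1 + 2 * \<alpha>) / c1 powr (1 + 2 * \<alpha>)"
        using c1 by (simp add: field_simps)
      then have "\<delta> \<le> ?J powr (1 + 2 * \<alpha>) / c1 powr (1 + 2 * \<alpha>) * (D * ?J powr (-\<alpha>))\<^sup>2"
        unfolding \<delta>_def by (intro mult_right_mono) auto
      also have "\<dots> = D' * (?J powr (1 + 2 * \<alpha>) * (?J powr (-\<alpha>))\<^sup>2)"
        by (simp add: D'_def power_mult_distrib)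
      also have "?J powr (1 + 2 * \<alpha>) * (?J powr (-\<alpha>))\<^sup>2 = ?J"
        using Jpos by (simp add: power2_eq_square powr_add[symmetric])
      finally show ?thesis .
    qed
    have \<delta>: "(\<Sum>i=1..n. (f\<^sub>0 (z n i) - ?B (b (J n)) i)\<^sup>2) \<le> \<delta>"
    proof -
      have "(f\<^sub>0 (z n i) - ?B (b (J n)) i)\<^sup>2 \<le> (D * ?J powr (-\<alpha>))\<^sup>2" if "i \<in> {1..n}" for i
        using b[OF Jq zn[OF that]] by (subst abs_le_square_iff[symmetric]) (simp add: abs_minus_commute)
      then show ?thesis
        using sum_bounded_above[of "{1..n}" "\<lambda>i. (f\<^sub>0 (z n i) - ?B (b (J n)) i)\<^sup>2"]
        by (simp add: \<delta>_def)
    qed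
    \<comment> \<open>The lower Gram bound turns a bound on the spline values into one on the
      coefficients. The values are at most \<open>F0 + D\<close>, because
      \<open>J powr (- \<alpha>) \<le> 1\<close>. Hence centring the prior at 0 instead of at the
      approximating coefficients costs only a term of order \<open>J\<close>.\<close>
    have b2: "(\<Sum>j=1..J n. (b (J n) j)\<^sup>2) \<le> ?J * ((F0 + D)\<^sup>2 / c)"
    proof -
      have "(?B (b (J n)) i)\<^sup>2 \<le> (F0 + D)\<^sup>2" if "i \<in> {1..n}" for i
      proof -
        have "?J powr (-\<alpha>) \<le> 1" using J1 \<alpha> by (simp add: powr_le1 powr_minus field_simps ge_one_powr_ge_zero)
        then have "D * ?J powr (-\<alpha>) \<le> D" using D by (simp add: mult_left_le)
        then have "\<bar>?B (b (J n)) i\<bar> \<le> F0 + D"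
          using b[OF Jq zn[OF that]] F0[OF zn[OF that]] by linarith
        then show ?thesis using F0_nonneg D by (simp add: abs_le_square_iff[symmetric])
      qed
      then have "(\<Sum>i=1..n. (?B (b (J n)) i)\<^sup>2) \<le> real n * (F0 + D)\<^sup>2"
        using sum_bounded_above[of "{1..n}" "\<lambda>i. (?B (b (J n)) i)\<^sup>2"] by simp
      then have "c * (real n / ?J) * (\<Sum>j=1..J n. (b (J n) j)\<^sup>2) \<le> real n * (F0 + D)\<^sup>2"
        using gl[of "b (J n)"] by linarith
      then show ?thesis using cC Jpos n by (simp add: field_simps)
    qed
    have \<rho>J: "\<rho> n * ?J \<le> c / (4 * C * \<sigma>\<^sup>2) * (real n * (M n * \<epsilon> n)\<^sup>2 / 2 - \<delta>)"
    proof -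
      have "(M n)\<^sup>2 / (2 * C1) * ?J \<le> (M n)\<^sup>2 / (2 * C1) * (C1 * real n powr s)"
        using elim(2) C1 by (intro mult_left_mono) auto
      also have "\<dots> = real n * (M n * \<epsilon> n)\<^sup>2 / 2"
        using C1 rate[OF n] by (simp add: power_mult_distrib)
      finally have "((M n)\<^sup>2 / (2 * C1) - D') * ?J \<le> real n * (M n * \<epsilon> n)\<^sup>2 / 2 - \<delta>"
        using \<delta>_le by (simp add: left_diff_distrib)
      then show ?thesis
        unfolding \<rho>_def mult.assoc using cC by (intro mult_left_mono) auto
    qed
    have "?p n \<le> (1 + (C / c * ?J + 2 * C / (c * \<sigma>\<^sup>2) * \<delta> + 2 * (\<Sum>j=1..J n. (b (J n) j)\<^sup>2)
             + ?J * (ln (2 * (1 + C / c)) / 2))) / (\<rho> n * ?J)"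
      using elim(6) by (intro expected_posterior_far_mass sigma_pos n J1 cC gl gu \<delta> \<rho>n \<rho>J)
        (simp add: \<epsilon>_def)
    also have "\<dots> \<le> (E * ?J) / (\<rho> n * ?J)"
    proof (rule divide_right_mono)
      have arith: "1 + (a * j + x * y + 2 * S + j * l) \<le> (1 + (a + x * w + 2 * G + l)) * j"
        if "x * y \<le> x * (w * j)" "S \<le> j * G" "1 \<le> j" for a x y w S G l j :: real
        using that by (simp add: algebra_simps)
      have "2 * C / (c * \<sigma>\<^sup>2) * \<delta> \<le> 2 * C / (c * \<sigma>\<^sup>2) * (D' * ?J)"
        using \<delta>_le cC by (intro mult_left_mono) auto
      then show "1 + (C / c * ?J + 2 * C / (c * \<sigma>\<^sup>2) * \<delta> + 2 * (\<Sum>j=1..J n. (b (J n) j)\<^sup>2)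
             + ?J * (ln (2 * (1 + C / c)) / 2)) \<le> E * ?J"
        unfolding E_def by (intro arith b2 J1)
    qed (use \<rho>n in simp)
    also have "\<dots> = E / \<rho> n" using Jpos by simp
    finally show ?case .
  qed
  have "(\<lambda>n. E / \<rho> n) \<longlonglongrightarrow> 0"
    by (rule tendsto_divide_0[OF tendsto_const filterlim_at_top_imp_at_infinity[OF \<rho>]])
  from tendsto_sandwich[OF _ bound tendsto_const this]
  have "?p \<longlonglongrightarrow> 0"
    by (simp add: Bochner_Integration.integral_nonneg posterior_nonneg)
  then show "(\<lambda>n. \<integral>X. posterior (z n) \<sigma> n (spline_prior q (t (J n)) (J n)) X
                   {f. design_norm (z n) n (\<lambda>x. f x - f\<^sub>0 x)
                     \<ge> M n * real n powr (- \<alpha> / (1 + 2 * \<alpha>))}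
              \<partial>regression_law (z n) \<sigma> n f\<^sub>0) \<longlonglongrightarrow> 0"
    by (simp add: \<epsilon>_def)
qed

end
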